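(* Let $K<\infty$ (the number of particles per processing element) be fixed, and let $\pi_n^{MK}$ be the random measures produced by the distributed particle filter described in the context, with $M$ processing elements and exchange period $n_0$. Assume the following. (1) There exists a bounded sequence of positive real numbers $\{a_n\}_{n\ge 0}$ such that $\frac{1}{a_n}\le g_n^{y_n}(x)\le a_n$ for every $x\in\mathcal X$ (and every $n\ge 1$), and $a=\sup_{n\ge 0}a_n<\infty$. (2) For any probability measures $\alpha,\eta\in\mathcal P(\mathcal X)$ and every $h\in B(\mathcal X)$, $$\mathcal E(h,T)=\sup_{n\ge 0}\left|(h,\Psi_{n+T|n}(\alpha))-(h,\Psi_{n+T|n}(\eta))\right|<\infty \quad\text{and}\quad \lim_{T\to\infty}\mathcal E(h,T)=0 .$$ (3) The particle exchange step, with period $n_0$, guarantees that $$E\left[\left(\sup_{1\le m\le M}W_{rn_0}^{(m)}\right)^q\right]\le\frac{c^q}{M^{q-\epsilon}}\quad\text{for every } r\in\mathbb N$$ and some constants $c<\infty$, $0\le\epsilon<1$ and $q\ge 4$ independent of $M$. Then the approximate measures computed by the algorithm converge uniformly over time in $L_p$; to be specific, $$\lim_{M\to\infty}\ \sup_{n\ge 0}\left\|(h,\pi_n^{MK})-(h,\pi_n)\right\|_p=0$$ for any $h\in B(\mathcal X)$ and every $1\le p\le q$, where $q\ge 4$ is the constant in (3).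
   Context: **State-space model.** $\mathcal X\subseteq\mathbb R^{d_x}$ is the state space, $\mathcal P(\mathcal X)$ the set of Borel probability measures on $\mathcal X$, $B(\mathcal X)$ the set of bounded real functions on $\mathcal X$, $\|h\|_\infty=\sup_{x\in\mathcal X}|h(x)|$. The model consists of a prior probability measure $\tau_0$ on $\mathcal X$, Markov kernels $\tau_n(dx|x_{n-1})$, $n\ge1$, from $\mathcal X$ to $\mathcal X$, and conditional densities $g_n(y|x)$ of the observation at time $n\ge 1$ (taking values in $\mathbb R^{d_y}$) given state $x$. The observation sequence $\{y_n\}_{n\ge1}$ is fixed, and $g_n^{y_n}(x)=g_n(y_n|x)$. For a measure $\alpha$ and an integrable $f$, $(f,\alpha)=\int f\,d\alpha$; for a kernel, $(f,\tau_n)$ denotes the function $x\mapsto\int f(x')\tau_n(dx'|x)$. For a real random variable $Z$ and $p\ge 1$, $\|Z\|_p=E[|Z|^p]^{1/p}$, where the expectation is over the randomness of the algorithm. **Optimal filter.** $\Psi_n:\mathcal P(\mathcal X)\to\mathcal P(\mathcal X)$ is defined by $(h,\Psi_n(\alpha))=\dfrac{((hg_n^{y_n},\tau_n),\alpha)}{((g_n^{y_n},\tau_n),\alpha)}$. For $s<n$, $\Psi_{n|s}=\Psi_n\circ\Psi_{n-1}\circ\cdots\circ\Psi_{s+1}$, and $\Psi_{n|n}$ is the identity. The filter measures (posterior distributions of the state at time $n$ given $y_1,\dots,y_n$) are $\pi_0=\tau_0$, $\pi_n=\Psi_n(\pi_{n-1})$, $n\ge1$. **Distributed particle filter** with $M$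 processing elements (PEs), $K$ particles per PE, exchange period $n_0\ge1$, and a deterministic one-to-one exchange map $\beta:\{1,\dots,M\}\times\{1,\dots,K\}\to\{1,\dots,M\}\times\{1,\dots,K\}$: - Initialization: draw $x_0^{(m,k)}\sim\tau_0$ independently, and set $w_0^{(m,k)*}=\frac1{MK}$, $W_0^{(m)*}=\frac1M$, for all $1\le m\le M$, $1\le k\le K$. - For $n\ge1$, given $\{x_{n-1}^{(m,k)},w_{n-1}^{(m,k)*}\}$: (a) draw (conditionally independently) $\bar x_n^{(m,k)}\sim\tau_n(dx|x_{n-1}^{(m,k)})$, and compute $\bar w_n^{(m,k)*}=w_{n-1}^{(m,k)*}g_n^{y_n}(\bar x_n^{(m,k)})$ and $\bar W_n^{(m)*}=\sum_{k=1}^K\bar w_n^{(m,k)*}$; (b) local multinomial resampling: for each $m$ and each $k$, conditionally independently, set $\tilde x_n^{(m,k)}=\bar x_n^{(m,j)}$ with probability $\bar w_n^{(m,j)*}/\bar W_n^{(m)*}$, $j\in\{1,\dots,K\}$; set $\tilde w_n^{(m,k)*}=\bar W_n^{(m)*}/K$; (c) particle exchange: if $n=rn_0$ for some $r\in\mathbb N$, set $x_n^{\beta(m,k)}=\tilde x_n^{(m,k)}$ and $w_n^{\beta(m,k)*}=\tilde w_n^{(m,k)*}$ for all $(m,k)$, and $W_n^{(m)*}=\sum_{k=1}^Kw_n^{(m,k)*}$; otherwise set $x_n^{(m,k)}=\tilde x_n^{(m,k)}$, $w_n^{(m,k)*}=\tilde w_n^{(m,k)*}$, $W_n^{(m)*}=\bar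 W_n^{(m)*}$. Normalized aggregate weights: $W_n^{(m)}=W_n^{(m)*}/\sum_{i=1}^MW_n^{(i)*}$. Locally normalized weights: $w_n^{(m,k)}=w_n^{(m,k)*}/\sum_{i=1}^Kw_n^{(m,i)*}$. The global approximation of $\pi_n$ is $$\pi_n^{MK}=\sum_{m=1}^MW_n^{(m)}\sum_{k=1}^Kw_n^{(m,k)}\delta_{x_n^{(m,k)}} .$$ All these quantities depend on $M$ although this is not shown in the notation.
   Formalization: In assumption (2), E(h,T) is the supremum over n and also over all probability measures α, η, so forgetting is uniform in the initial measures; with α, η fixed before the limit the claim is false. B(X) is taken to consist of Borel measurable bounded functions. *)

theory Defs
  imports "HOL-Probability.Probability"
begin

section \<open>State-space models and the optimal filter\<close>

abbreviation borel_on :: "'x::topological_space set \<Rightarrow> 'x measure"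
  where "borel_on X \<equiv> restrict_space borel X"

definition prob_measures_on :: "'x::topological_space set \<Rightarrow> 'x measure set"
  where "prob_measures_on X = space (prob_algebra (borel_on X))"

definition bounded_functions :: "'x::topological_space set \<Rightarrow> ('x \<Rightarrow> real) set"
  where "bounded_functions X = {h \<in> borel_measurable (borel_on X). bounded (h ` X)}"

text \<open>
  The density \<open>g n y x\<close> of the observation at time \<open>n \<ge> 1\<close> given state \<open>x\<close> is taken with
  respect to Lebesgue measure on the observation space.
\<close>

locale state_space_model =
  fixes X :: "'x::euclidean_space set"
    and tau0 :: "'x measure"
    and tau :: "nat \<Rightarrow> 'x \<Rightarrow> 'x measure"
    and g :: "nat \<Rightarrow> 'y::euclidean_space \<Rightarrow> 'x \<Rightarrow> real"
  assumes prior: "tau0 \<in> prob_measures_on X"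
    and kernel: "n \<ge> 1 \<Longrightarrow> tau n \<in> borel_on X \<rightarrow>\<^sub>M prob_algebra (borel_on X)"
    and density_measurable:
      "n \<ge> 1 \<Longrightarrow> (\<lambda>(y, x). g n y x) \<in> borel_measurable (borel \<Otimes>\<^sub>M borel_on X)"
    and density_nonneg: "n \<ge> 1 \<Longrightarrow> x \<in> X \<Longrightarrow> g n y x \<ge> 0"
    and density_integral: "n \<ge> 1 \<Longrightarrow> x \<in> X \<Longrightarrow> (\<integral>\<^sup>+ y. ennreal (g n y x) \<partial>lborel) = 1"

text \<open>
  From here on the observations are fixed and \<open>G n x\<close> stands for \<open>g n (y n) x\<close>.
  \<open>Psi tau G n\<close> is the map \<open>\<Psi>\<^sub>n\<close>; its defining formula for \<open>(h, \<Psi>\<^sub>n(\<alpha>))\<close>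
  is lemma \<open>integral_Psi\<close> below.
\<close>

definition Psi ::
    "(nat \<Rightarrow> 'x \<Rightarrow> 'x measure) \<Rightarrow> (nat \<Rightarrow> 'x \<Rightarrow> real) \<Rightarrow> nat \<Rightarrow> 'x measure \<Rightarrow> 'x measure"
  where "Psi tau G n \<alpha> =
    density (\<alpha> \<bind> tau n)
      (\<lambda>x. ennreal (G n x / (\<integral>x'. (\<integral>x''. G n x'' \<partial>tau n x') \<partial>\<alpha>)))"

text \<open>\<open>Psi_flow tau G n s\<close> is \<open>\<Psi>\<^sub>n \<circ> \<dots> \<circ> \<Psi>\<^bsub>s+1\<^esub>\<close> for \<open>s < n\<close> and the identity for \<open>s = n\<close>.\<close>

primrec Psi_flow ::
    "(nat \<Rightarrow> 'x \<Rightarrow> 'x measure) \<Rightarrow> (nat \<Rightarrow> 'x \<Rightarrow> real) \<Rightarrow> nat \<Rightarrow> nat \<Rightarrow> 'x measure \<Rightarrow> 'x measure"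
  where
    "Psi_flow tau G 0 s \<alpha> = \<alpha>"
  | "Psi_flow tau G (Suc n) s \<alpha> =
      (if s \<le> n then Psi tau G (Suc n) (Psi_flow tau G n s \<alpha>) else \<alpha>)"

primrec filter_measure ::
    "'x measure \<Rightarrow> (nat \<Rightarrow> 'x \<Rightarrow> 'x measure) \<Rightarrow> (nat \<Rightarrow> 'x \<Rightarrow> real) \<Rightarrow> nat \<Rightarrow> 'x measure"
  where
    "filter_measure tau0 tau G 0 = tau0"
  | "filter_measure tau0 tau G (Suc n) = Psi tau G (Suc n) (filter_measure tau0 tau G n)"

text \<open>
  \<open>\<E>(h, T)\<close> depends on \<open>h\<close> and \<open>T\<close> only, so the supremum is taken over the starting time
  and over both initial measures. A rate for each fixed pair of
  initial measures would not control the filter, whose measures may drift away to where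
  forgetting is arbitrarily slow.
\<close>

definition forgetting_error ::
    "'x::topological_space set \<Rightarrow> (nat \<Rightarrow> 'x \<Rightarrow> 'x measure) \<Rightarrow> (nat \<Rightarrow> 'x \<Rightarrow> real) \<Rightarrow>
     ('x \<Rightarrow> real) \<Rightarrow> nat \<Rightarrow> ereal"
  where "forgetting_error X tau G h T =
    (SUP \<alpha>\<in>prob_measures_on X. SUP \<eta>\<in>prob_measures_on X. SUP n.
      ereal \<bar>(\<integral>x. h x \<partial>Psi_flow tau G (n + T) n \<alpha>) - (\<integral>x. h x \<partial>Psi_flow tau G (n + T) n \<eta>)\<bar>)"


section \<open>The distributed particle filter\<close>

abbreviation particles :: "nat \<Rightarrow> nat \<Rightarrow> (nat \<times> nat) set"
  where "particles M K \<equiv> {1..M} \<times> {1..K}"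

text \<open>
  A configuration \<open>(x, w)\<close> consists of the states \<open>x (m, k)\<close> and the unnormalized weights
  \<open>w (m, k)\<close> (starred in the literature). The weights live in the positive reals, which the
  algorithm never leaves when the likelihoods are positive.
\<close>

type_synonym 'x config = "(nat \<times> nat \<Rightarrow> 'x) \<times> (nat \<times> nat \<Rightarrow> real)"

definition config_space :: "'x::topological_space set \<Rightarrow> nat \<Rightarrow> nat \<Rightarrow> 'x config measure"
  where "config_space X M K =
    PiM (particles M K) (\<lambda>_. borel_on X) \<Otimes>\<^sub>M PiM (particles M K) (\<lambda>_. borel_on {0<..})"

text \<open>
  The unnormalized aggregate weight is always the sum of the weights in the processing element:
  the initial weights add up to \<open>K \<sqdot> 1/(MK) = 1/M\<close>, and resampling leaves \<open>K\<close> copies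
  of a \<open>K\<close>-th of the aggregate weight.
\<close>

definition aggregate_weight :: "nat \<Rightarrow> 'x config \<Rightarrow> nat \<Rightarrow> real"
  where "aggregate_weight K c m = (\<Sum>k\<in>{1..K}. snd c (m, k))"

definition normalized_aggregate_weight :: "nat \<Rightarrow> nat \<Rightarrow> 'x config \<Rightarrow> nat \<Rightarrow> real"
  where "normalized_aggregate_weight M K c m =
    aggregate_weight K c m / (\<Sum>i\<in>{1..M}. aggregate_weight K c i)"

definition local_weight :: "nat \<Rightarrow> 'x config \<Rightarrow> nat \<Rightarrow> nat \<Rightarrow> real"
  where "local_weight K c m k = snd c (m, k) / (\<Sum>i\<in>{1..K}. snd c (m, i))"

text \<open>\<open>weighted_diracs N I p x\<close> is the measure \<open>\<Sum>i\<in>I. p i \<sqdot> \<delta>(x i)\<close> on the measurable space \<open>N\<close>.\<close>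

definition weighted_diracs :: "'x measure \<Rightarrow> 'i set \<Rightarrow> ('i \<Rightarrow> real) \<Rightarrow> ('i \<Rightarrow> 'x) \<Rightarrow> 'x measure"
  where "weighted_diracs N I p x = distr (point_measure I (\<lambda>i. ennreal (p i))) N x"

definition dpf_measure ::
    "'x::topological_space set \<Rightarrow> nat \<Rightarrow> nat \<Rightarrow> 'x config \<Rightarrow> 'x measure"
  where "dpf_measure X M K c =
    weighted_diracs (borel_on X) (particles M K)
      (\<lambda>(m, k). normalized_aggregate_weight M K c m * local_weight K c m k) (fst c)"

definition dpf_init :: "'x::topological_space set \<Rightarrow> 'x measure \<Rightarrow> nat \<Rightarrow> nat \<Rightarrow> 'x config measure"
  where "dpf_init X tau0 M K =
    distr (PiM (particles M K) (\<lambda>_. tau0)) (config_space X M K)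
      (\<lambda>x. (x, \<lambda>i\<in>particles M K. 1 / (real M * real K)))"

definition dpf_sample ::
    "'x::topological_space set \<Rightarrow> (nat \<Rightarrow> 'x \<Rightarrow> 'x measure) \<Rightarrow> (nat \<Rightarrow> 'x \<Rightarrow> real) \<Rightarrow>
     nat \<Rightarrow> nat \<Rightarrow> nat \<Rightarrow> 'x config \<Rightarrow> 'x config measure"
  where "dpf_sample X tau G M K n c =
    distr (PiM (particles M K) (\<lambda>i. tau n (fst c i))) (config_space X M K)
      (\<lambda>x. (x, \<lambda>i\<in>particles M K. snd c i * G n (x i)))"

definition dpf_resample ::
    "'x::topological_space set \<Rightarrow> nat \<Rightarrow> nat \<Rightarrow> 'x config \<Rightarrow> 'x config measure"
  where "dpf_resample X M K c =
    distr
      (PiM (particles M K)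
        (\<lambda>(m, k). weighted_diracs (borel_on X) {1..K}
          (\<lambda>j. snd c (m, j) / aggregate_weight K c m) (\<lambda>j. fst c (m, j))))
      (config_space X M K)
      (\<lambda>x. (x, \<lambda>(m, k)\<in>particles M K. aggregate_weight K c m / real K))"

text \<open>At exchange times the particle (and weight) at slot \<open>i\<close> moves to slot \<open>\<beta> i\<close>.\<close>

definition dpf_exchange ::
    "nat \<Rightarrow> nat \<Rightarrow> nat \<Rightarrow> (nat \<times> nat \<Rightarrow> nat \<times> nat) \<Rightarrow> nat \<Rightarrow> 'x config \<Rightarrow> 'x config"
  where "dpf_exchange M K n0 \<beta> n c =
    (if n0 dvd n
     then (\<lambda>i\<in>particles M K. fst c (inv_into (particles M K) \<beta> i),
           \<lambda>i\<in>particles M K. snd c (inv_into (particles M K) \<beta> i))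
     else c)"

definition dpf_step ::
    "'x::topological_space set \<Rightarrow> (nat \<Rightarrow> 'x \<Rightarrow> 'x measure) \<Rightarrow> (nat \<Rightarrow> 'x \<Rightarrow> real) \<Rightarrow>
     nat \<Rightarrow> nat \<Rightarrow> nat \<Rightarrow> (nat \<times> nat \<Rightarrow> nat \<times> nat) \<Rightarrow> nat \<Rightarrow> 'x config \<Rightarrow> 'x config measure"
  where "dpf_step X tau G M K n0 \<beta> n c =
    dpf_sample X tau G M K n c \<bind>
      (\<lambda>c'. distr (dpf_resample X M K c') (config_space X M K) (dpf_exchange M K n0 \<beta> n))"

text \<open>
  The configurations form a Markov chain, and \<open>dpf_law X tau0 tau G M K n0 \<beta> n\<close> is the law of
  the configuration at time \<open>n\<close>. Any expectation of a function of the configuration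
  at a single time is an integral with respect to this law.
\<close>

primrec dpf_law ::
    "'x::topological_space set \<Rightarrow> 'x measure \<Rightarrow> (nat \<Rightarrow> 'x \<Rightarrow> 'x measure) \<Rightarrow> (nat \<Rightarrow> 'x \<Rightarrow> real) \<Rightarrow>
     nat \<Rightarrow> nat \<Rightarrow> nat \<Rightarrow> (nat \<times> nat \<Rightarrow> nat \<times> nat) \<Rightarrow> nat \<Rightarrow> 'x config measure"
  where
    "dpf_law X tau0 tau G M K n0 \<beta> 0 = dpf_init X tau0 M K"
  | "dpf_law X tau0 tau G M K n0 \<beta> (Suc n) =
      dpf_law X tau0 tau G M K n0 \<beta> n \<bind> dpf_step X tau G M K n0 \<beta> (Suc n)"

definition Lp_norm :: "'a measure \<Rightarrow> real \<Rightarrow> ('a \<Rightarrow> real) \<Rightarrow> real"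
  where "Lp_norm P p Z = (\<integral>\<omega>. \<bar>Z \<omega>\<bar> powr p \<partial>P) powr (1 / p)"


section \<open>Well-definedness\<close>

lemma integral_Psi:
  fixes X :: "'x::topological_space set"
  assumes \<alpha>: "\<alpha> \<in> prob_measures_on X"
    and tau: "tau n \<in> borel_on X \<rightarrow>\<^sub>M prob_algebra (borel_on X)"
    and G: "G n \<in> borel_measurable (borel_on X)"
    and bounds: "\<And>x. x \<in> X \<Longrightarrow> l \<le> G n x \<and> G n x \<le> u" and "0 < l"
    and h: "h \<in> bounded_functions X"
  shows "Psi tau G n \<alpha> \<in> prob_measures_on X"
    and "(\<integral>x. h x \<partial>Psi tau G n \<alpha>) =
      (\<integral>x. (\<integral>x'. h x' * G n x' \<partial>tau n x) \<partial>\<alpha>) / (\<integral>x. (\<integral>x'. G n x' \<partial>tau n x) \<partial>\<alpha>)"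
proof -
  have sets_a[measurable_cong]: "sets \<alpha> = sets (borel_on X)" and pa: "prob_space \<alpha>"
    using \<alpha> by (auto simp: prob_measures_on_def space_prob_algebra)
  have a_in: "\<alpha> \<in> space (prob_algebra (borel_on X))"
    using \<alpha> by (simp add: prob_measures_on_def)
  have space_a: "space \<alpha> = X"
    using sets_eq_imp_space_eq[OF sets_a] by (simp add: space_restrict_space)
  define N where "N = \<alpha> \<bind> tau n"
  have sets_N[measurable_cong]: "sets N = sets (borel_on X)" and pN: "prob_space N"
    unfolding N_def using sets_bind'[OF a_in tau] prob_space_bind'[OF a_in tau] by auto
  interpret N: prob_space N by fact
  have space_N: "space N = X"
    using sets_eq_imp_space_eq[OF sets_N] by (simp add: space_restrict_space)
  have tau': "tau n \<in> \<alpha> \<rightarrow>\<^sub>M subprob_algebra (borel_on X)"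
    using measurable_prob_algebraD[OF tau] by (simp add: measurable_cong_sets[OF sets_a refl])
  have bind_int: "(\<integral>x. f x \<partial>N) = (\<integral>x. (\<integral>x'. f x' \<partial>tau n x) \<partial>\<alpha>)"
    if f: "f \<in> borel_measurable (borel_on X)" and B: "\<And>x. x \<in> X \<Longrightarrow> \<bar>f x\<bar> \<le> B" for f :: "'x \<Rightarrow> real" and B
    unfolding N_def
  proof (rule integral_bind[where K="borel_on X" and B=B and B'=1])
    show "finite_measure \<alpha>" using pa by (simp add: prob_space_def)
  next
    have "prob_space (tau n x)" if "x \<in> space \<alpha>" for x
      using that measurable_space[OF tau, of x]
      by (simp add: space_prob_algebra space_a space_restrict_space)
    then show "AE x in \<alpha>. emeasure (tau n x) (space (tau n x)) \<le> ennreal 1"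
      by (intro AE_I2) (simp add: prob_space.emeasure_space_1)
  qed (use f B tau' pa in \<open>auto simp: space_restrict_space prob_space.not_empty\<close>)
  obtain b where b: "\<And>x. x \<in> X \<Longrightarrow> \<bar>h x\<bar> \<le> b"
    using h unfolding bounded_functions_def bounded_iff by auto
  have hm: "h \<in> borel_measurable (borel_on X)" using h by (simp add: bounded_functions_def)
  have Gu: "\<And>x. x \<in> X \<Longrightarrow> \<bar>G n x\<bar> \<le> u" using bounds \<open>0 < l\<close> by fastforce
  have hG: "\<bar>h x * G n x\<bar> \<le> b * u" if "x \<in> X" for x
    using b[OF that] Gu[OF that] by (simp add: abs_mult mult_mono')
  define Z where "Z = (\<integral>x. G n x \<partial>N)"
  have Z: "Z = (\<integral>x. (\<integral>x'. G n x' \<partial>tau n x) \<partial>\<alpha>)"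
    unfolding Z_def using bind_int[OF G Gu] .
  have GN: "G n \<in> borel_measurable N" and hN: "h \<in> borel_measurable N"
    using G hm by (auto simp: measurable_cong_sets[OF sets_N refl])
  have int_G: "integrable N (G n)"
    using GN Gu by (intro N.integrable_const_bound[where B=u]) (auto simp: space_N)
  have "l \<le> Z"
    unfolding Z_def using bounds by (intro N.integral_ge_const[OF int_G] AE_I2) (auto simp: space_N)
  then have Zpos: "Z > 0" using \<open>0 < l\<close> by simp
  have eq: "Psi tau G n \<alpha> = density N (\<lambda>x. ennreal (G n x / Z))"
    unfolding Psi_def N_def Z ..
  have nn: "AE x in N. 0 \<le> G n x / Z"
    using bounds \<open>0 < l\<close> Zpos by (intro AE_I2) (fastforce simp: space_N)
  have "(\<integral>\<^sup>+ x. ennreal (G n x / Z) \<partial>N) = ennreal (\<integral>x. G n x / Z \<partial>N)"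
    using int_G nn by (intro nn_integral_eq_integral) auto
  also have "(\<integral>x. G n x / Z \<partial>N) = 1" using Zpos by (simp add: Z_def[symmetric])
  finally have "prob_space (density N (\<lambda>x. ennreal (G n x / Z)))"
    using GN by (intro prob_spaceI) (simp add: emeasure_density cong: nn_integral_cong)
  then show "Psi tau G n \<alpha> \<in> prob_measures_on X"
    unfolding eq prob_measures_on_def by (simp add: space_prob_algebra sets_N)
  have "(\<integral>x. h x \<partial>Psi tau G n \<alpha>) = (\<integral>x. G n x / Z * h x \<partial>N)"
    unfolding eq using hN GN nn by (subst integral_density) auto
  also have "\<dots> = (\<integral>x. (h x * G n x) / Z \<partial>N)" by (simp add: mult_ac)
  also have "\<dots> = (\<integral>x. h x * G n x \<partial>N) / Z" by simp
  also have "(\<integral>x. h x * G n x \<partial>N) = (\<integral>x. (\<integral>x'. h x' * G n x' \<partial>tau n x) \<partial>\<alpha>)"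
    using hm G by (intro bind_int[OF _ hG]) auto
  finally show "(\<integral>x. h x \<partial>Psi tau G n \<alpha>) =
      (\<integral>x. (\<integral>x'. h x' * G n x' \<partial>tau n x) \<partial>\<alpha>) / (\<integral>x. (\<integral>x'. G n x' \<partial>tau n x) \<partial>\<alpha>)"
    by (simp add: Z)
qed

lemma integral_weighted_diracs:
  assumes "finite I" "\<And>i. i \<in> I \<Longrightarrow> p i \<ge> 0" "\<And>i. i \<in> I \<Longrightarrow> x i \<in> space N"
    and "h \<in> borel_measurable N"
  shows "(\<integral>z. h z \<partial>weighted_diracs N I p x) = (\<Sum>i\<in>I. p i * h (x i))"
  unfolding weighted_diracs_def
  using assms by (subst integral_distr) (auto simp: lebesgue_integral_point_measure_finite)

lemma prob_space_weighted_diracs: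
  assumes "finite I" "\<And>i. i \<in> I \<Longrightarrow> p i \<ge> 0" "\<And>i. i \<in> I \<Longrightarrow> x i \<in> space N"
    and "(\<Sum>i\<in>I. p i) = 1"
  shows "prob_space (weighted_diracs N I p x)"
  unfolding weighted_diracs_def
  using assms by (intro prob_space.prob_space_distr prob_space_point_measure) auto

lemma emeasure_weighted_diracs:
  assumes "finite I" "\<And>i. i \<in> I \<Longrightarrow> p i \<ge> 0" "\<And>i. i \<in> I \<Longrightarrow> x i \<in> space N" "A \<in> sets N"
  shows "emeasure (weighted_diracs N I p x) A = (\<Sum>i\<in>I. ennreal (p i) * indicator A (x i))"
proof -
  have "emeasure (weighted_diracs N I p x) A = (\<Sum>i\<in>x -` A \<inter> I. ennreal (p i))"
    unfolding weighted_diracs_def using assms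
    by (subst emeasure_distr) (auto simp: space_point_measure emeasure_point_measure_finite2)
  also have "\<dots> = (\<Sum>i\<in>I. ennreal (p i) * indicator A (x i))"
    using assms(1) by (auto intro!: sum.mono_neutral_cong_left simp: indicator_def)
  finally show ?thesis .
qed

lemma measurable_PiM_kernel:
  assumes I: "finite I" and f: "\<And>i. i \<in> I \<Longrightarrow> f i \<in> L \<rightarrow>\<^sub>M prob_algebra N"
  shows "(\<lambda>c. PiM I (\<lambda>i. f i c)) \<in> L \<rightarrow>\<^sub>M prob_algebra (PiM I (\<lambda>_. N))"
proof (rule measurable_prob_algebra_generated[OF sets_PiM Int_stable_prod_algebra prod_algebra_sets_into_space])
  fix c assume c: "c \<in> space L"
  have fc: "prob_space (f i c)" "sets (f i c) = sets N" if "i \<in> I" for i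
    using measurable_space[OF f[OF that] c] by (auto simp: space_prob_algebra)
  show "prob_space (PiM I (\<lambda>i. f i c))" using fc by (intro prob_space_PiM) auto
  show "sets (PiM I (\<lambda>i. f i c)) = sets (PiM I (\<lambda>_. N))" using fc by (intro sets_PiM_cong) auto
next
  fix A assume "A \<in> prod_algebra I (\<lambda>_. N)"
  then obtain J E where A: "A = prod_emb I (\<lambda>_. N) J (Pi\<^sub>E J E)" "finite J" "J \<subseteq> I"
      "\<And>i. i \<in> J \<Longrightarrow> E i \<in> sets N"
    by (auto elim!: prod_algebraE)
  have eq: "emeasure (PiM I (\<lambda>i. f i c)) A = (\<Prod>i\<in>J. emeasure (f i c) (E i))"
    if c: "c \<in> space L" for c
  proof -
    have fc: "prob_space (f i c)" "sets (f i c) = sets N" if "i \<in> I" for i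
      using measurable_space[OF f[OF that] c] by (auto simp: space_prob_algebra)
    have "A = prod_emb I (\<lambda>i. f i c) J (Pi\<^sub>E J E)"
      unfolding A(1) prod_emb_def using fc(2)[THEN sets_eq_imp_space_eq] by (auto cong: PiE_cong)
    then show ?thesis
      using A fc by (auto intro!: emeasure_PiM_emb)
  qed
  have "(\<lambda>c. \<Prod>i\<in>J. emeasure (f i c) (E i)) \<in> borel_measurable L"
  proof (rule borel_measurable_prod_ennreal)
    fix i assume i: "i \<in> J"
    with A f have "f i \<in> L \<rightarrow>\<^sub>M subprob_algebra N" by (intro measurable_prob_algebraD) auto
    then show "(\<lambda>c. emeasure (f i c) (E i)) \<in> borel_measurable L"
      using A(4)[OF i] by (rule measurable_emeasure_kernel)
  qed
  then show "(\<lambda>c. emeasure (PiM I (\<lambda>i. f i c)) A) \<in> borel_measurable L"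
    using eq by (simp cong: measurable_cong)
qed

context
  fixes X :: "'x::topological_space set" and tau0 :: "'x measure"
    and tau :: "nat \<Rightarrow> 'x \<Rightarrow> 'x measure" and G :: "nat \<Rightarrow> 'x \<Rightarrow> real" and M K :: nat
  assumes MK: "M \<ge> 1" "K \<ge> 1"
    and tau0: "tau0 \<in> prob_measures_on X"
    and tau: "\<And>n. n \<ge> 1 \<Longrightarrow> tau n \<in> borel_on X \<rightarrow>\<^sub>M prob_algebra (borel_on X)"
    and G: "\<And>n. n \<ge> 1 \<Longrightarrow> G n \<in> borel_measurable (borel_on X)"
    and G_pos: "\<And>n x. n \<ge> 1 \<Longrightarrow> x \<in> X \<Longrightarrow> G n x > 0"
begin

lemma measurable_config_state:
  "i \<in> particles M K \<Longrightarrow> (\<lambda>c. fst c i) \<in> config_space X M K \<rightarrow>\<^sub>M borel_on X"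
  unfolding config_space_def by measurable

lemma measurable_config_weight:
  "i \<in> particles M K \<Longrightarrow> (\<lambda>c. snd c i) \<in> config_space X M K \<rightarrow>\<^sub>M borel_on {0<..}"
  unfolding config_space_def by measurable

lemma measurable_config_weight':
  "i \<in> particles M K \<Longrightarrow> (\<lambda>c. snd c i) \<in> borel_measurable (config_space X M K)"
  using measurable_config_weight[of i] by (simp add: measurable_restrict_space2_iff)

lemma config_state_in:
  "c \<in> space (config_space X M K) \<Longrightarrow> i \<in> particles M K \<Longrightarrow> fst c i \<in> X"
  using measurable_space[OF measurable_config_state] by (simp add: space_restrict_space)

lemma config_weight_pos:
  "c \<in> space (config_space X M K) \<Longrightarrow> i \<in> particles M K \<Longrightarrow> snd c i > 0"
  using measurable_space[OF measurable_config_weight] by (simp add: space_restrict_space)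

lemma aggregate_weight_pos:
  assumes "c \<in> space (config_space X M K)" "m \<in> {1..M}"
  shows "aggregate_weight K c m > 0"
  unfolding aggregate_weight_def using assms MK config_weight_pos by (intro sum_pos) auto

lemma measurable_aggregate_weight:
  "m \<in> {1..M} \<Longrightarrow> (\<lambda>c. aggregate_weight K c m) \<in> borel_measurable (config_space X M K)"
  unfolding aggregate_weight_def by (intro borel_measurable_sum measurable_config_weight') auto

lemma prob_space_dpf_measure:
  assumes c: "c \<in> space (config_space X M K)"
  shows "prob_space (dpf_measure X M K c)"
  unfolding dpf_measure_def
proof (rule prob_space_weighted_diracs)
  have W: "aggregate_weight K c m > 0" if "m \<in> {1..M}" for m
    using aggregate_weight_pos[OF c that] .
  have Wsum: "(\<Sum>i\<in>{1..M}. aggregate_weight K c i) > 0"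
    using W MK by (intro sum_pos) auto
  have "(\<Sum>k\<in>{1..K}. local_weight K c m k) = 1" if "m \<in> {1..M}" for m
    using W[OF that] unfolding local_weight_def aggregate_weight_def
    by (simp add: sum_divide_distrib[symmetric])
  then have "(\<Sum>m\<in>{1..M}. \<Sum>k\<in>{1..K}. normalized_aggregate_weight M K c m * local_weight K c m k)
      = (\<Sum>m\<in>{1..M}. normalized_aggregate_weight M K c m)"
    by (intro sum.cong refl) (simp add: sum_distrib_left[symmetric])
  also have "\<dots> = 1"
    using Wsum unfolding normalized_aggregate_weight_def by (simp add: sum_divide_distrib[symmetric])
  finally show "(\<Sum>i\<in>particles M K. case i of (m, k) \<Rightarrow>
      normalized_aggregate_weight M K c m * local_weight K c m k) = 1"
    by (simp add: sum.cartesian_product)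
  fix i assume i: "i \<in> particles M K"
  then obtain m k where mk: "i = (m, k)" "m \<in> {1..M}" "k \<in> {1..K}" by auto
  show "0 \<le> (case i of (m, k) \<Rightarrow> normalized_aggregate_weight M K c m * local_weight K c m k)"
    using mk W[OF mk(2)] Wsum config_weight_pos[OF c i]
    unfolding normalized_aggregate_weight_def local_weight_def aggregate_weight_def by auto
  show "fst c i \<in> space (borel_on X)"
    using config_state_in[OF c i] by (simp add: space_restrict_space)
qed simp

lemma dpf_init_in: "dpf_init X tau0 M K \<in> space (prob_algebra (config_space X M K))"
proof -
  have t: "sets tau0 = sets (borel_on X)" "prob_space tau0"
    using tau0 by (auto simp: prob_measures_on_def space_prob_algebra)
  have "(\<lambda>x. (x, \<lambda>i\<in>particles M K. 1 / (real M * real K))) \<in> (PiM (particles M K) (\<lambda>_. borel_on X)) \<rightarrow>\<^sub>M config_space X M K"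
    unfolding config_space_def
    using MK by (intro measurable_Pair measurable_ident_sets refl measurable_restrict)
      (auto simp: space_restrict_space)
  moreover have "sets (PiM (particles M K) (\<lambda>_. tau0)) = sets (PiM (particles M K) (\<lambda>_. borel_on X))" using t by (intro sets_PiM_cong) auto
  ultimately have "(\<lambda>x. (x, \<lambda>i\<in>particles M K. 1 / (real M * real K))) \<in> PiM (particles M K) (\<lambda>_. tau0) \<rightarrow>\<^sub>M config_space X M K"
    by (simp cong: measurable_cong_sets)
  then show ?thesis
    unfolding dpf_init_def space_prob_algebra using t
    by (auto intro!: prob_space.prob_space_distr prob_space_PiM)
qed

lemma measurable_dpf_sample:
  assumes n: "n \<ge> 1"
  shows "dpf_sample X tau G M K n \<in> config_space X M K \<rightarrow>\<^sub>M prob_algebra (config_space X M K)"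
  unfolding dpf_sample_def
proof (rule measurable_distr_prob_space2)
  show "(\<lambda>c. PiM (particles M K) (\<lambda>i. tau n (fst c i))) \<in> config_space X M K \<rightarrow>\<^sub>M prob_algebra (PiM (particles M K) (\<lambda>_. borel_on X))"
    using tau[OF n] measurable_config_state
    by (intro measurable_PiM_kernel) (auto intro: measurable_compose)
  have w: "(\<lambda>z. snd (fst z) i * G n (snd z i)) \<in> config_space X M K \<Otimes>\<^sub>M (PiM (particles M K) (\<lambda>_. borel_on X)) \<rightarrow>\<^sub>M borel_on {0<..}"
    if i: "i \<in> particles M K" for i
  proof (rule measurable_restrict_space2)
    have x: "(\<lambda>z. snd z i) \<in> config_space X M K \<Otimes>\<^sub>M (PiM (particles M K) (\<lambda>_. borel_on X)) \<rightarrow>\<^sub>M borel_on X"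
      using i by measurable
    show "(\<lambda>z. snd (fst z) i * G n (snd z i)) \<in> borel_measurable (config_space X M K \<Otimes>\<^sub>M (PiM (particles M K) (\<lambda>_. borel_on X)))"
      using measurable_compose[OF measurable_fst measurable_config_weight'[OF i]]
        measurable_compose[OF x G[OF n]] by (intro borel_measurable_times) auto
    show "(\<lambda>z. snd (fst z) i * G n (snd z i)) \<in> space (config_space X M K \<Otimes>\<^sub>M (PiM (particles M K) (\<lambda>_. borel_on X))) \<rightarrow> {0<..}"
      using config_weight_pos[OF _ i] G_pos[OF n] measurable_space[OF x]
      by (auto simp: space_pair_measure space_restrict_space)
  qed
  have "(\<lambda>z. (snd z, \<lambda>i\<in>particles M K. snd (fst z) i * G n (snd z i)))
      \<in> config_space X M K \<Otimes>\<^sub>M (PiM (particles M K) (\<lambda>_. borel_on X)) \<rightarrow>\<^sub>M (PiM (particles M K) (\<lambda>_. borel_on X)) \<Otimes>\<^sub>M (PiM (particles M K) (\<lambda>_. borel_on {0<..}))"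
    using w by (intro measurable_Pair measurable_snd measurable_restrict) auto
  then show "(\<lambda>(c, x). (x, \<lambda>i\<in>particles M K. snd c i * G n (x i)))
      \<in> config_space X M K \<Otimes>\<^sub>M (PiM (particles M K) (\<lambda>_. borel_on X)) \<rightarrow>\<^sub>M config_space X M K"
    by (simp add: config_space_def case_prod_beta')
qed

lemma measurable_dpf_resample:
  "dpf_resample X M K \<in> config_space X M K \<rightarrow>\<^sub>M prob_algebra (config_space X M K)"
  unfolding dpf_resample_def
proof (rule measurable_distr_prob_space2)
  let ?D = "\<lambda>m c. weighted_diracs (borel_on X) {1..K}
    (\<lambda>j. snd c (m, j) / aggregate_weight K c m) (\<lambda>j. fst c (m, j))"
  have D: "?D m \<in> config_space X M K \<rightarrow>\<^sub>M prob_algebra (borel_on X)" if m: "m \<in> {1..M}" for m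
  proof (rule measurable_prob_algebra_generated[where G = "sets (borel_on X)" and \<Omega> = "space (borel_on X)"])
    have p: "0 \<le> snd c (m, j) / aggregate_weight K c m"
      if "c \<in> space (config_space X M K)" "j \<in> {1..K}" for c j
      using that m config_weight_pos[of c "(m, j)"] aggregate_weight_pos[of c m] by auto
    have x: "fst c (m, j) \<in> space (borel_on X)"
      if "c \<in> space (config_space X M K)" "j \<in> {1..K}" for c j
      using that m config_state_in[of c "(m, j)"] by (auto simp: space_restrict_space)
    show "prob_space (?D m c)" if c: "c \<in> space (config_space X M K)" for c
    proof (rule prob_space_weighted_diracs)
      show "(\<Sum>j\<in>{1..K}. snd c (m, j) / aggregate_weight K c m) = 1"
        using aggregate_weight_pos[OF c m]
        by (simp add: sum_divide_distrib[symmetric] aggregate_weight_def)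
    qed (use p x c in auto)
    show "sets (?D m c) = sets (borel_on X)" for c by (simp add: weighted_diracs_def)
    show "(\<lambda>c. emeasure (?D m c) A) \<in> borel_measurable (config_space X M K)"
      if A: "A \<in> sets (borel_on X)" for A
    proof -
      have "(\<lambda>c. \<Sum>j\<in>{1..K}. ennreal (snd c (m, j) / aggregate_weight K c m) * indicator A (fst c (m, j)))
          \<in> borel_measurable (config_space X M K)"
      proof (intro borel_measurable_sum borel_measurable_times_ennreal)
        fix j assume j: "j \<in> {1..K}"
        show "(\<lambda>c. ennreal (snd c (m, j) / aggregate_weight K c m)) \<in> borel_measurable (config_space X M K)"
          using measurable_config_weight'[of "(m, j)"] measurable_aggregate_weight[OF m] j m by auto
        have "(m, j) \<in> particles M K" using j m by auto
        then show "(\<lambda>c. indicator A (fst c (m, j))) \<in> borel_measurable (config_space X M K)"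
          by (rule measurable_compose[OF measurable_config_state borel_measurable_indicator[OF A]])
      qed
      moreover have "emeasure (?D m c) A =
          (\<Sum>j\<in>{1..K}. ennreal (snd c (m, j) / aggregate_weight K c m) * indicator A (fst c (m, j)))"
        if "c \<in> space (config_space X M K)" for c
        using that p x A by (intro emeasure_weighted_diracs) auto
      ultimately show ?thesis by (simp cong: measurable_cong)
    qed
  qed (auto simp: sets.sigma_sets_eq sets.Int_stable sets.space_closed)
  show "(\<lambda>c. PiM (particles M K) (\<lambda>(m, k). ?D m c)) \<in> config_space X M K \<rightarrow>\<^sub>M prob_algebra (PiM (particles M K) (\<lambda>_. borel_on X))"
    using measurable_PiM_kernel[where f="\<lambda>i. ?D (fst i)" and I="particles M K", OF _ D]
    by (auto simp: case_prod_beta')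
  have w: "(\<lambda>z. aggregate_weight K (fst z) m / real K) \<in> config_space X M K \<Otimes>\<^sub>M (PiM (particles M K) (\<lambda>_. borel_on X)) \<rightarrow>\<^sub>M borel_on {0<..}"
    if m: "m \<in> {1..M}" for m
  proof (rule measurable_restrict_space2)
    show "(\<lambda>z. aggregate_weight K (fst z) m / real K) \<in> borel_measurable (config_space X M K \<Otimes>\<^sub>M (PiM (particles M K) (\<lambda>_. borel_on X)))"
      using measurable_compose[OF measurable_fst measurable_aggregate_weight[OF m]]
      by (intro borel_measurable_divide) auto
    show "(\<lambda>z. aggregate_weight K (fst z) m / real K) \<in> space (config_space X M K \<Otimes>\<^sub>M (PiM (particles M K) (\<lambda>_. borel_on X))) \<rightarrow> {0<..}"
      using aggregate_weight_pos[OF _ m] MK by (auto simp: space_pair_measure)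
  qed
  have "(\<lambda>z. (snd z, \<lambda>i\<in>particles M K. aggregate_weight K (fst z) (fst i) / real K))
      \<in> config_space X M K \<Otimes>\<^sub>M (PiM (particles M K) (\<lambda>_. borel_on X)) \<rightarrow>\<^sub>M (PiM (particles M K) (\<lambda>_. borel_on X)) \<Otimes>\<^sub>M (PiM (particles M K) (\<lambda>_. borel_on {0<..}))"
    using w by (intro measurable_Pair measurable_snd measurable_restrict) auto
  then show "(\<lambda>(c, x). (x, \<lambda>(m, k)\<in>particles M K. aggregate_weight K c m / real K))
      \<in> config_space X M K \<Otimes>\<^sub>M (PiM (particles M K) (\<lambda>_. borel_on X)) \<rightarrow>\<^sub>M config_space X M K"
    by (simp add: config_space_def case_prod_beta')
qed

lemma measurable_dpf_exchange:
  assumes "bij_betw \<beta> (particles M K) (particles M K)"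
  shows "dpf_exchange M K n0 \<beta> n \<in> config_space X M K \<rightarrow>\<^sub>M config_space X M K"
proof (cases "n0 dvd n")
  case True
  have inv: "inv_into (particles M K) \<beta> i \<in> particles M K" if "i \<in> particles M K" for i
    using assms that by (metis bij_betw_imp_surj_on inv_into_into)
  have "(\<lambda>c. (\<lambda>i\<in>particles M K. fst c (inv_into (particles M K) \<beta> i), \<lambda>i\<in>particles M K. snd c (inv_into (particles M K) \<beta> i)))
      \<in> config_space X M K \<rightarrow>\<^sub>M (PiM (particles M K) (\<lambda>_. borel_on X)) \<Otimes>\<^sub>M (PiM (particles M K) (\<lambda>_. borel_on {0<..}))"
    using inv by (intro measurable_Pair measurable_restrict measurable_config_state measurable_config_weight) auto
  then show ?thesis
    using True by (simp add: dpf_exchange_def[abs_def] config_space_def)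
qed (simp add: dpf_exchange_def[abs_def])

lemma measurable_dpf_step:
  assumes \<beta>: "bij_betw \<beta> (particles M K) (particles M K)" and n: "n \<ge> 1"
  shows "dpf_step X tau G M K n0 \<beta> n \<in> config_space X M K \<rightarrow>\<^sub>M prob_algebra (config_space X M K)"
  unfolding dpf_step_def
  using measurable_compose[OF measurable_dpf_resample
      measurable_distr_prob_space[OF measurable_dpf_exchange[OF \<beta>]]]
  by (rule measurable_bind_prob_space[OF measurable_dpf_sample[OF n]])

lemma dpf_law_in:
  assumes \<beta>: "bij_betw \<beta> (particles M K) (particles M K)"
  shows "dpf_law X tau0 tau G M K n0 \<beta> n \<in> space (prob_algebra (config_space X M K))"
proof (induction n)
  case 0
  show ?case by (simp add: dpf_init_in)
next
  case (Suc n)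
  have "dpf_step X tau G M K n0 \<beta> (Suc n) \<in> config_space X M K \<rightarrow>\<^sub>M prob_algebra (config_space X M K)"
    by (rule measurable_dpf_step[OF \<beta>]) simp
  from prob_space_bind'[OF Suc this] sets_bind'[OF Suc this] show ?case
    by (simp add: space_prob_algebra)
qed

end

end

theory Submission
  imports Defs
begin

text \<open>
  Write \<open>F z = (h, \<pi>(z))\<close> for the estimate read off a configuration \<open>z\<close> and \<open>S z\<close> for its largest
  normalized aggregate weight. Given \<open>z\<close>, the sampling and the resampling step average conditionally
  independent, bounded variables with weights at most a multiple of \<open>S z\<close>, so by a variance estimate
  one step of the algorithm differs from \<open>\<Psi>\<^sub>n\<close> by \<open>O(sqrt (S z))\<close> in mean. Since \<open>\<Psi>\<^sub>n\<close> is Lipschitz when tested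
  against bounded functions, after \<open>T\<close> steps the error with respect to \<open>\<Psi>\<close> started at \<open>\<pi>(z)\<close> is at
  most \<open>C\<^sup>T\<close> times a sum of \<open>T\<close> such terms, while forgetting bounds the effect of replacing \<open>\<pi>(z)\<close> by the
  true filter \<open>T\<close> steps earlier. Hypothesis (3) makes the mean of \<open>sqrt S\<close> vanish at exchange times,
  and between exchanges \<open>S\<close> grows by a bounded factor; so fix \<open>T\<close> first and then let \<open>M\<close> grow. As all
  estimates are bounded by the bound of \<open>h\<close>, convergence in \<open>L\<^sub>1\<close> gives convergence in every \<open>L\<^sub>p\<close>.
\<close>

section \<open>Weighted averages of independent variables\<close>

lemma integral_PiM_component:
  fixes f :: "'a \<Rightarrow> real"
  assumes P: "\<And>i. i \<in> I \<Longrightarrow> prob_space (P i)" and i: "i \<in> I" and f: "f \<in> borel_measurable (P i)"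
  shows "(\<integral>x. f (x i) \<partial>PiM I P) = (\<integral>z. f z \<partial>P i)"
proof -
  have "(\<integral>z. f z \<partial>distr (PiM I P) (P i) (\<lambda>x. x i)) = (\<integral>x. f (x i) \<partial>PiM I P)"
    using i f by (intro integral_distr) auto
  then show ?thesis using distr_PiM_component[of I P i] P i by simp
qed

text \<open>Independence of two coordinates, read off from the product formula for integrals by
  giving every other coordinate the constant factor 1.\<close>

lemma integral_PiM_mult_components:
  fixes f :: "'i \<Rightarrow> 'a \<Rightarrow> real"
  assumes fin: "finite I" and P: "\<And>i. i \<in> I \<Longrightarrow> prob_space (P i)"
    and ij: "i \<in> I" "j \<in> I" "i \<noteq> j" and f: "integrable (P i) (f i)" "integrable (P j) (f j)"
  shows "(\<integral>x. f i (x i) * f j (x j) \<partial>PiM I P) = (\<integral>z. f i z \<partial>P i) * (\<integral>z. f j z \<partial>P j)"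
proof -
  \<comment> \<open>The product formula asks for a sigma-finite measure at every index of the type,
    so the indices outside \<open>I\<close> receive a copy of \<open>P i\<close>.\<close>
  define Q where "Q k = (if k \<in> I then P k else P i)" for k
  have Q: "prob_space (Q k)" for k using P ij by (auto simp: Q_def)
  interpret Q: product_sigma_finite Q
    by (intro product_sigma_finite.intro prob_space_imp_sigma_finite Q)
  define u where "u k = (if k = i \<or> k = j then f k else (\<lambda>_. 1))" for k
  have PQ: "PiM I P = PiM I Q" by (intro PiM_cong) (auto simp: Q_def)
  have prod2: "(\<Prod>k\<in>I. v k) = v i * v j" if "\<And>k. k \<in> I \<Longrightarrow> k \<noteq> i \<Longrightarrow> k \<noteq> j \<Longrightarrow> v k = 1" for v :: "'i \<Rightarrow> real"
  proof -
    have "(\<Prod>k\<in>I. v k) = (\<Prod>k\<in>{i, j}. v k)"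
      using that fin ij by (intro prod.mono_neutral_right) auto
    then show ?thesis using ij by simp
  qed
  have "(\<integral>x. (\<Prod>k\<in>I. u k (x k)) \<partial>PiM I Q) = (\<Prod>k\<in>I. \<integral>z. u k z \<partial>Q k)"
  proof (rule Q.product_integral_prod[OF fin])
    fix k assume "k \<in> I"
    interpret prob_space "Q k" by (rule Q)
    have "integrable (Q k) (\<lambda>_. 1 :: real)" by simp
    then show "integrable (Q k) (u k)" using f ij by (auto simp: u_def Q_def)
  qed
  also have "(\<Prod>k\<in>I. \<integral>z. u k z \<partial>Q k) = (\<integral>z. u i z \<partial>Q i) * (\<integral>z. u j z \<partial>Q j)"
    by (rule prod2) (simp add: u_def prob_space.prob_space[OF Q])
  also have "(\<lambda>x. \<Prod>k\<in>I. u k (x k)) = (\<lambda>x. u i (x i) * u j (x j))"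
    by (rule ext, rule prod2) (simp add: u_def)
  finally show ?thesis using ij unfolding PQ[symmetric] by (simp add: u_def Q_def)
qed

text \<open>Jensen's inequality for the square. The nonnegative integral in the conclusion lets
  errors be integrated along kernels later on without integrability conditions.\<close>

lemma nn_integral_abs_le_sqrt:
  fixes f :: "'a \<Rightarrow> real"
  assumes "prob_space N" and f: "f \<in> borel_measurable N" "integrable N (\<lambda>x. (f x)\<^sup>2)"
    and v: "(\<integral>x. (f x)\<^sup>2 \<partial>N) \<le> v"
  shows "(\<integral>\<^sup>+x. ennreal \<bar>f x\<bar> \<partial>N) \<le> ennreal (sqrt v)"
proof -
  interpret prob_space N by fact
  have i: "integrable N (\<lambda>x. \<bar>f x\<bar>)"
    using square_integrable_imp_integrable[OF f] by simp
  have "(\<integral>x. \<bar>f x\<bar> \<partial>N)\<^sup>2 \<le> (\<integral>x. \<bar>f x\<bar>\<^sup>2 \<partial>N)"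
    using jensens_inequality[OF i, of UNIV _ _ "\<lambda>x. x\<^sup>2"] f by (auto simp: convex_power2)
  also have "\<dots> \<le> v" using v by simp
  finally have "(\<integral>x. \<bar>f x\<bar> \<partial>N) \<le> sqrt v" by (rule real_le_rsqrt)
  then show ?thesis using i by (simp add: nn_integral_eq_integral ennreal_leI)
qed

text \<open>After centring, the mixed terms of the square vanish by independence, and each diagonal
  term is a variance, at most \<open>b\<^sup>2\<close>. The passage to the first moment is Jensen's
  inequality.\<close>

lemma PiM_deviation:
  fixes f :: "'i \<Rightarrow> 'a \<Rightarrow> real"
  assumes fin: "finite I" and P: "\<And>i. i \<in> I \<Longrightarrow> prob_space (P i)"
    and f: "\<And>i. i \<in> I \<Longrightarrow> f i \<in> borel_measurable (P i)"
    and b: "\<And>i z. i \<in> I \<Longrightarrow> z \<in> space (P i) \<Longrightarrow> \<bar>f i z\<bar> \<le> b"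
  shows "(\<integral>\<^sup>+x. ennreal \<bar>\<Sum>i\<in>I. p i * (f i (x i) - (\<integral>z. f i z \<partial>P i))\<bar> \<partial>PiM I P)
    \<le> ennreal (sqrt (\<Sum>i\<in>I. (p i)\<^sup>2 * b\<^sup>2))"
proof -
  interpret PM: prob_space "PiM I P" by (intro prob_space_PiM P)
  define m where "m i = (\<integral>z. f i z \<partial>P i)" for i
  define u where "u i z = f i z - m i" for i z
  have fi: "integrable (P i) (f i)" if "i \<in> I" for i
    using f[OF that] b[OF that]
    by (intro finite_measure.integrable_const_bound[where B=b] prob_space.finite_measure P that AE_I2) auto
  have ui: "integrable (P i) (u i)" if "i \<in> I" for i
    using fi[OF that] unfolding u_def
    by (intro Bochner_Integration.integrable_diff finite_measure.integrable_const prob_space.finite_measure P that)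
  have mb: "\<bar>m i\<bar> \<le> b" if "i \<in> I" for i
  proof -
    interpret prob_space "P i" by (rule P[OF that])
    have "\<bar>m i\<bar> \<le> (\<integral>z. \<bar>f i z\<bar> \<partial>P i)" unfolding m_def using integral_abs_bound by auto
    also have "\<dots> \<le> b"
      using fi[OF that] b[OF that] by (intro integral_le_const AE_I2) auto
    finally show ?thesis .
  qed
  have um: "(\<lambda>x. u i (x i)) \<in> borel_measurable (PiM I P)" if "i \<in> I" for i
    using f[OF that] that unfolding u_def by auto
  have ub: "\<bar>u i (x i)\<bar> \<le> 2 * b" if "i \<in> I" "x \<in> space (PiM I P)" for i x
    using b[of i "x i"] mb[of i] that by (auto simp: u_def space_PiM PiE_iff)
  have u0: "(\<integral>z. u i z \<partial>P i) = 0" if i: "i \<in> I" for i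
  proof -
    interpret prob_space "P i" by (rule P[OF i])
    show ?thesis using fi[OF i] by (simp add: u_def m_def prob_space)
  qed
  \<comment> \<open>Bounding the variance by the second moment of \<open>f i\<close> gives
    \<open>b\<^sup>2\<close>; the cruder pointwise bound \<open>2 * b\<close> serves integrability
    only.\<close>
  have u2: "(\<integral>z. (u i z)\<^sup>2 \<partial>P i) \<le> b\<^sup>2" if i: "i \<in> I" for i
  proof -
    interpret prob_space "P i" by (rule P[OF i])
    have b2: "(f i z)\<^sup>2 \<le> b\<^sup>2" if "z \<in> space (P i)" for z
      using power_mono[OF b[OF i that], of 2] by simp
    have f2: "integrable (P i) (\<lambda>z. (f i z)\<^sup>2)"
      using f[OF i] b2 by (intro integrable_const_bound[where B="b\<^sup>2"] AE_I2) auto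
    have "(\<integral>z. (u i z)\<^sup>2 \<partial>P i) = (\<integral>z. (f i z)\<^sup>2 \<partial>P i) - (m i)\<^sup>2"
      unfolding u_def m_def using fi[OF i] f2 by (rule variance_eq)
    also have "\<dots> \<le> (\<integral>z. (f i z)\<^sup>2 \<partial>P i)" by simp
    also have "\<dots> \<le> b\<^sup>2" using f2 b2 by (intro integral_le_const AE_I2) auto
    finally show ?thesis .
  qed
  have uu_i: "integrable (PiM I P) (\<lambda>x. u i (x i) * u j (x j))" if "i \<in> I" "j \<in> I" for i j
  proof (rule PM.integrable_const_bound[where B="(2*b)*(2*b)"], rule AE_I2)
    show "norm (u i (x i) * u j (x j)) \<le> (2*b)*(2*b)" if "x \<in> space (PiM I P)" for x
      using mult_mono'[OF ub ub abs_ge_zero abs_ge_zero] that \<open>i \<in> I\<close> \<open>j \<in> I\<close> by (simp add: abs_mult)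
  qed (use um that in auto)
  have uu: "(\<integral>x. u i (x i) * u i (x i) \<partial>PiM I P) \<le> b\<^sup>2" if i: "i \<in> I" for i
  proof -
    have "(\<integral>x. (\<lambda>z. (u i z)\<^sup>2) (x i) \<partial>PiM I P) = (\<integral>z. (u i z)\<^sup>2 \<partial>P i)"
      using f[OF i] by (intro integral_PiM_component P i) (auto simp: u_def)
    then show ?thesis using u2[OF i] by (simp add: power2_eq_square)
  qed
  have uu_eq0: "(\<integral>x. u i (x i) * u j (x j) \<partial>PiM I P) = 0" if ij: "i \<in> I" "j \<in> I" "i \<noteq> j" for i j
      using integral_PiM_mult_components[of I P i j u] fin P ij ui u0 by auto
  have sq: "(\<Sum>i\<in>I. p i * u i (x i))\<^sup>2 = (\<Sum>i\<in>I. \<Sum>j\<in>I. p i * p j * (u i (x i) * u j (x j)))" for x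
    by (simp add: power2_eq_square sum_product mult_ac)
  have int: "integrable (PiM I P) (\<lambda>x. (\<Sum>i\<in>I. p i * u i (x i))\<^sup>2)"
    unfolding sq using uu_i by auto
  have "(\<integral>x. (\<Sum>i\<in>I. p i * u i (x i))\<^sup>2 \<partial>PiM I P)
      = (\<Sum>i\<in>I. \<Sum>j\<in>I. p i * p j * (\<integral>x. u i (x i) * u j (x j) \<partial>PiM I P))"
    unfolding sq using uu_i by (simp add: Bochner_Integration.integral_sum)
  also have "\<dots> \<le> (\<Sum>i\<in>I. \<Sum>j\<in>I. if i = j then (p i)\<^sup>2 * b\<^sup>2 else 0)"
    using uu uu_eq0 by (intro sum_mono) (auto intro!: mult_left_mono simp: power2_eq_square[of "p _"])
  also have "\<dots> = (\<Sum>i\<in>I. (p i)\<^sup>2 * b\<^sup>2)" using fin by (simp add: sum.delta')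
  finally have le: "(\<integral>x. (\<Sum>i\<in>I. p i * u i (x i))\<^sup>2 \<partial>PiM I P) \<le> (\<Sum>i\<in>I. (p i)\<^sup>2 * b\<^sup>2)" .
  have "(\<integral>\<^sup>+x. ennreal \<bar>\<Sum>i\<in>I. p i * u i (x i)\<bar> \<partial>PiM I P) \<le> ennreal (sqrt (\<Sum>i\<in>I. (p i)\<^sup>2 * b\<^sup>2))"
    using um by (intro nn_integral_abs_le_sqrt PM.prob_space_axioms int le) auto
  then show ?thesis by (simp add: u_def m_def)
qed

text \<open>One factor of \<open>(p i)\<^sup>2\<close> is bounded by \<open>s\<close>, and the
  remaining factors add up to 1. With \<open>s\<close> the largest weight this produces the rate
  \<open>sqrt s\<close> of the Monte Carlo errors.\<close>

lemma sqrt_sum_squares_le: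
  fixes b :: real
  assumes p: "\<And>i. i \<in> I \<Longrightarrow> 0 \<le> p i \<and> p i \<le> s" and "(\<Sum>i\<in>I. p i) = 1"
  shows "sqrt (\<Sum>i\<in>I. (p i)\<^sup>2 * b\<^sup>2) \<le> \<bar>b\<bar> * sqrt s"
proof -
  have "(\<Sum>i\<in>I. (p i)\<^sup>2 * b\<^sup>2) \<le> (\<Sum>i\<in>I. p i * (s * b\<^sup>2))"
    using p by (intro sum_mono) (auto simp: power2_eq_square mult.assoc intro!: mult_left_mono mult_right_mono)
  also have "\<dots> = s * b\<^sup>2" using assms(2) by (simp add: sum_distrib_right[symmetric])
  finally have "sqrt (\<Sum>i\<in>I. (p i)\<^sup>2 * b\<^sup>2) \<le> sqrt (s * b\<^sup>2)" by simp
  then show ?thesis by (simp add: real_sqrt_mult mult.commute)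
qed

text \<open>Writing the difference as \<open>((a - c) - c / d * (b - d)) / b\<close> leaves only
  \<open>b\<close> to be bounded below. The quotient \<open>c / d\<close> will be an integral
  against a probability measure, hence has a direct bound.\<close>

lemma abs_ratio_diff_le:
  fixes a b c d A B :: real
  assumes "A > 0" and b: "1 / A \<le> b" and d: "d > 0" and B: "\<bar>c / d\<bar> \<le> B"
  shows "\<bar>a / b - c / d\<bar> \<le> A * (\<bar>a - c\<bar> + B * \<bar>b - d\<bar>)"
proof -
  have "0 < 1 / A" using \<open>A > 0\<close> by simp
  with b have "b > 0" by linarith
  have "1 / b \<le> 1 / (1 / A)" using b \<open>0 < 1 / A\<close> by (rule frac_le[OF zero_le_one order_refl, rotated])
  then have bA: "1 / b \<le> A" by simp
  have "0 \<le> B" using B by linarith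
  have "a / b - c / d = ((a - c) - c / d * (b - d)) * (1 / b)"
    using \<open>b > 0\<close> d by (simp add: field_simps)
  then have "\<bar>a / b - c / d\<bar> = \<bar>(a - c) - c / d * (b - d)\<bar> * (1 / b)"
    using \<open>b > 0\<close> by (simp only: abs_mult) simp
  also have "\<dots> \<le> (\<bar>a - c\<bar> + B * \<bar>b - d\<bar>) * A"
  proof (rule mult_mono[OF _ bA])
    have "\<bar>c / d * (b - d)\<bar> \<le> B * \<bar>b - d\<bar>"
      unfolding abs_mult using B by (rule mult_right_mono) simp
    then show "\<bar>(a - c) - c / d * (b - d)\<bar> \<le> \<bar>a - c\<bar> + B * \<bar>b - d\<bar>" by linarith
    show "0 \<le> \<bar>a - c\<bar> + B * \<bar>b - d\<bar>" using \<open>0 \<le> B\<close> by simp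
  qed (use \<open>b > 0\<close> in simp)
  finally show ?thesis by (simp only: mult.commute)
qed

section \<open>Comparison of moments\<close>

lemma (in prob_space) nn_integral_prob_const: "(\<integral>\<^sup>+x. c \<partial>M) = c"
  by (simp add: emeasure_space_1)

text \<open>All but one power of a bounded variable can be replaced by its bound, so the p-th moment
  is at most \<open>b powr (p - 1)\<close> times the first.\<close>

lemma Lp_norm_le_L1:
  assumes N: "prob_space N" and Z: "Z \<in> borel_measurable N"
    and b: "\<And>\<omega>. \<omega> \<in> space N \<Longrightarrow> \<bar>Z \<omega>\<bar> \<le> b" and p: "1 \<le> p" and "0 \<le> d"
    and d: "(\<integral>\<^sup>+\<omega>. ennreal \<bar>Z \<omega>\<bar> \<partial>N) \<le> ennreal d"
  shows "Lp_norm N p Z \<le> (b powr (p - 1) * d) powr (1 / p)"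
proof -
  interpret prob_space N by fact
  have Zi: "integrable N (\<lambda>\<omega>. \<bar>Z \<omega>\<bar>)"
    using Z b by (intro integrable_const_bound[where B=b] AE_I2) auto
  have pw: "\<bar>Z \<omega>\<bar> powr p \<le> b powr (p - 1) * \<bar>Z \<omega>\<bar>" if "\<omega> \<in> space N" for \<omega>
  proof -
    have "\<bar>Z \<omega>\<bar> powr p = \<bar>Z \<omega>\<bar> powr (p - 1) * \<bar>Z \<omega>\<bar> powr 1"
      unfolding powr_add[symmetric] by simp
    also have "\<dots> \<le> b powr (p - 1) * \<bar>Z \<omega>\<bar>"
      using b[OF that] p by (auto intro!: mult_right_mono powr_mono2)
    finally show ?thesis .
  qed
  have Zpi: "integrable N (\<lambda>\<omega>. \<bar>Z \<omega>\<bar> powr p)"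
    using Z b p by (intro integrable_const_bound[where B="b powr p"] AE_I2) (auto intro!: powr_mono2)
  have "(\<integral>\<omega>. \<bar>Z \<omega>\<bar> \<partial>N) \<le> d"
    using d Zi \<open>0 \<le> d\<close> by (simp add: nn_integral_eq_integral)
  moreover have "(\<integral>\<omega>. \<bar>Z \<omega>\<bar> powr p \<partial>N) \<le> (\<integral>\<omega>. b powr (p - 1) * \<bar>Z \<omega>\<bar> \<partial>N)"
    using Zi Zpi pw by (intro integral_mono) auto
  ultimately have "(\<integral>\<omega>. \<bar>Z \<omega>\<bar> powr p \<partial>N) \<le> b powr (p - 1) * d"
    using mult_left_mono[of "\<integral>\<omega>. \<bar>Z \<omega>\<bar> \<partial>N" d "b powr (p - 1)"] by simp
  then show ?thesis
    unfolding Lp_norm_def using p by (intro powr_mono2) auto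
qed

text \<open>Where \<open>sqrt w\<close> exceeds \<open>t\<close>, multiplying it by
  \<open>(sqrt w / t) powr (2 * q - 1)\<close>, which is at least 1, gives the second summand. The
  bound is linear in \<open>w powr q\<close>, so integrating it turns a q-th moment into a bound on
  the mean of the square root.\<close>

lemma sqrt_le_powr:
  assumes w: "0 < (w::real)" and t: "0 < t" and q: "1 \<le> q"
  shows "sqrt w \<le> t + w powr q / t powr (2 * q - 1)"
proof (cases "sqrt w \<le> t")
  case True
  have "0 \<le> w powr q / t powr (2 * q - 1)" by simp
  with True show ?thesis by linarith
next
  case False
  have "t powr (2 * q - 1) \<le> sqrt w powr (2 * q - 1)"
    using False t q by (intro powr_mono2) auto
  then have "sqrt w * t powr (2 * q - 1) \<le> sqrt w powr 1 * sqrt w powr (2 * q - 1)"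
    using w by (simp add: mult_left_mono)
  also have "\<dots> = w powr q"
    using w unfolding powr_add[symmetric] powr_half_sqrt[OF less_imp_le[OF w], symmetric] powr_powr
    by (simp add: diff_divide_distrib)
  finally have "sqrt w \<le> w powr q / t powr (2 * q - 1)"
    using t by (simp add: le_divide_eq)
  then show ?thesis using t by linarith
qed

section \<open>Configurations\<close>

text \<open>The number of processing elements stays fixed in this locale, and one constant
  \<open>A\<close> stands for all the bounds \<open>a n\<close>. With \<open>A \<ge> 1\<close> its
  powers increase, so different powers can be merged.\<close>

locale particle_filter =
  fixes X :: "'x::topological_space set" and tau0 :: "'x measure"
    and tau :: "nat \<Rightarrow> 'x \<Rightarrow> 'x measure" and G :: "nat \<Rightarrow> 'x \<Rightarrow> real"
    and M K n0 :: nat and \<beta> :: "nat \<times> nat \<Rightarrow> nat \<times> nat" and A :: real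
  assumes M: "M \<ge> 1" and K: "K \<ge> 1"
    and tau0: "tau0 \<in> prob_measures_on X"
    and tau: "\<And>n. n \<ge> 1 \<Longrightarrow> tau n \<in> borel_on X \<rightarrow>\<^sub>M prob_algebra (borel_on X)"
    and G: "\<And>n. n \<ge> 1 \<Longrightarrow> G n \<in> borel_measurable (borel_on X)"
    and G_bounds: "\<And>n x. n \<ge> 1 \<Longrightarrow> x \<in> X \<Longrightarrow> 1 / A \<le> G n x \<and> G n x \<le> A"
    and A: "A \<ge> 1"
    and \<beta>: "bij_betw \<beta> (particles M K) (particles M K)"
begin

lemma G_pos: "n \<ge> 1 \<Longrightarrow> x \<in> X \<Longrightarrow> G n x > 0"
  using G_bounds[of n x] A by (auto intro: less_le_trans[of 0 "1 / A"])

abbreviation "configs \<equiv> config_space X M K"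
abbreviation "law \<equiv> dpf_law X tau0 tau G M K n0 \<beta>"
abbreviation "step \<equiv> dpf_step X tau G M K n0 \<beta>"
abbreviation "estimate \<equiv> dpf_measure X M K"

section \<open>Well-definedness of the algorithm, restated in the locale\<close>

lemma state_measurable: "i \<in> particles M K \<Longrightarrow> (\<lambda>z. fst z i) \<in> configs \<rightarrow>\<^sub>M borel_on X"
  by (rule measurable_config_state[OF M K tau0]) (assumption | rule tau G G_pos)+

lemma weight_measurable: "i \<in> particles M K \<Longrightarrow> (\<lambda>z. snd z i) \<in> borel_measurable configs"
  by (rule measurable_config_weight'[OF M K tau0]) (assumption | rule tau G G_pos)+

lemma state_in: "z \<in> space configs \<Longrightarrow> i \<in> particles M K \<Longrightarrow> fst z i \<in> X"
  by (rule config_state_in[OF M K tau0]) (assumption | rule tau G G_pos)+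

lemma weight_pos: "z \<in> space configs \<Longrightarrow> i \<in> particles M K \<Longrightarrow> snd z i > 0"
  by (rule config_weight_pos[OF M K tau0]) (assumption | rule tau G G_pos)+

lemma aggregate_pos: "z \<in> space configs \<Longrightarrow> m \<in> {1..M} \<Longrightarrow> aggregate_weight K z m > 0"
  by (rule aggregate_weight_pos[OF M K tau0]) (assumption | rule tau G G_pos)+

lemma aggregate_measurable: "m \<in> {1..M} \<Longrightarrow> (\<lambda>z. aggregate_weight K z m) \<in> borel_measurable configs"
  by (rule measurable_aggregate_weight[OF M K tau0]) (assumption | rule tau G G_pos)+

lemma prob_space_estimate: "z \<in> space configs \<Longrightarrow> prob_space (estimate z)"
  by (rule prob_space_dpf_measure[OF M K tau0]) (assumption | rule tau G G_pos)+

lemma resample_measurable: "dpf_resample X M K \<in> configs \<rightarrow>\<^sub>M prob_algebra configs"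
  by (rule measurable_dpf_resample[OF M K tau0]) (assumption | rule tau G G_pos)+

lemma exchange_measurable: "dpf_exchange M K n0 \<beta> n \<in> configs \<rightarrow>\<^sub>M configs"
  by (rule measurable_dpf_exchange[OF M K tau0]) (assumption | rule \<beta> tau G G_pos)+

lemma step_measurable: "n \<ge> 1 \<Longrightarrow> step n \<in> configs \<rightarrow>\<^sub>M prob_algebra configs"
  by (rule measurable_dpf_step[OF M K tau0]) (assumption | rule \<beta> tau G G_pos)+

lemma law_in: "law n \<in> space (prob_algebra configs)"
  by (rule dpf_law_in[OF M K tau0]) (assumption | rule \<beta> tau G G_pos)+

section \<open>Normalized weights and the estimate\<close>

definition total :: "'x config \<Rightarrow> real" where "total z = (\<Sum>i\<in>particles M K. snd z i)"

text \<open>This is the supremum of hypothesis (3), so that the hypothesis applies by unfolding. It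
  measures the share of a processing element, not of a single particle.\<close>

definition max_weight :: "'x config \<Rightarrow> real"
  where "max_weight z = (SUP m\<in>{1..M}. normalized_aggregate_weight M K z m)"

lemma particles_not_empty: "particles M K \<noteq> {}"
  using M K by auto

lemma sum_aggregate: "(\<Sum>m\<in>{1..M}. aggregate_weight K z m) = total z"
  by (simp add: total_def aggregate_weight_def sum.cartesian_product)

lemma normalized_aggregate_eq: "normalized_aggregate_weight M K z m = aggregate_weight K z m / total z"
  unfolding normalized_aggregate_weight_def sum_aggregate ..

lemma local_weight_eq: "local_weight K z m k = snd z (m, k) / aggregate_weight K z m"
  unfolding local_weight_def aggregate_weight_def ..

lemma total_pos: "z \<in> space configs \<Longrightarrow> total z > 0"
  unfolding total_def using particles_not_empty by (intro sum_pos weight_pos) auto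

lemma estimate_in: "z \<in> space configs \<Longrightarrow> estimate z \<in> prob_measures_on X"
  using prob_space_estimate[of z]
  by (simp add: prob_measures_on_def space_prob_algebra dpf_measure_def weighted_diracs_def)

text \<open>The aggregate weight cancels between the global and the local normalization. What
  remains is one weighted average over all particles, in which the grouping into processing elements
  is no longer visible.\<close>

lemma integral_estimate:
  fixes h :: "'x \<Rightarrow> real"
  assumes z: "z \<in> space configs" and h: "h \<in> borel_measurable (borel_on X)"
  shows "(\<integral>x. h x \<partial>estimate z) = (\<Sum>i\<in>particles M K. snd z i / total z * h (fst z i))"
proof -
  have *: "(case i of (m, k) \<Rightarrow> normalized_aggregate_weight M K z m * local_weight K z m k)
      = snd z i / total z" if i: "i \<in> particles M K" for i
    using i aggregate_pos[OF z, of "fst i"]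
    by (auto simp: normalized_aggregate_eq local_weight_eq)
  have "(\<integral>x. h x \<partial>estimate z) = (\<Sum>i\<in>particles M K.
      (case i of (m, k) \<Rightarrow> normalized_aggregate_weight M K z m * local_weight K z m k) * h (fst z i))"
    unfolding dpf_measure_def
    using z h weight_pos[OF z] state_in[OF z] total_pos[OF z]
    by (intro integral_weighted_diracs) (simp_all only: *, simp_all add: space_restrict_space less_imp_le)
  then show ?thesis using * by simp
qed

lemma estimate_measurable:
  fixes h :: "'x \<Rightarrow> real"
  assumes h: "h \<in> borel_measurable (borel_on X)"
  shows "(\<lambda>z. \<integral>x. h x \<partial>estimate z) \<in> borel_measurable configs"
proof -
  have "(\<lambda>z. \<Sum>i\<in>particles M K. snd z i / total z * h (fst z i)) \<in> borel_measurable configs"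
    unfolding total_def
    by (intro borel_measurable_sum borel_measurable_times borel_measurable_divide weight_measurable
        measurable_compose[OF state_measurable h])
  then show ?thesis using integral_estimate[OF _ h] by (simp cong: measurable_cong)
qed

lemma max_weight_ge:
  "m \<in> {1..M} \<Longrightarrow> aggregate_weight K z m / total z \<le> max_weight z"
  unfolding max_weight_def normalized_aggregate_eq by (intro cSUP_upper) auto

lemma max_weight_le:
  "(\<And>m. m \<in> {1..M} \<Longrightarrow> aggregate_weight K z m / total z \<le> c) \<Longrightarrow> max_weight z \<le> c"
  unfolding max_weight_def normalized_aggregate_eq using M by (intro cSUP_least) auto

lemma max_weight_pos: "z \<in> space configs \<Longrightarrow> 0 < max_weight z"
  using max_weight_ge[of 1 z] M aggregate_pos[of z 1] total_pos[of z]
  by (auto intro: less_le_trans[of 0 "aggregate_weight K z 1 / total z"])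

lemma max_weight_le_1:
  assumes z: "z \<in> space configs"
  shows "max_weight z \<le> 1"
proof (rule max_weight_le)
  fix m assume m: "m \<in> {1..M}"
  have "aggregate_weight K z m \<le> (\<Sum>m\<in>{1..M}. aggregate_weight K z m)"
    using m aggregate_pos[OF z] by (intro member_le_sum) (auto simp: less_imp_le)
  then show "aggregate_weight K z m / total z \<le> 1"
    unfolding sum_aggregate using total_pos[OF z] by simp
qed

lemma max_weight_measurable [measurable]: "max_weight \<in> borel_measurable configs"
  unfolding max_weight_def[abs_def] normalized_aggregate_eq total_def
  by (intro borel_measurable_cSUP borel_measurable_divide borel_measurable_sum
      aggregate_measurable weight_measurable) auto

lemma max_weight_cong:
  "(\<And>m. m \<in> {1..M} \<Longrightarrow> aggregate_weight K z m = aggregate_weight K z' m) \<Longrightarrow> max_weight z = max_weight z'"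
  unfolding max_weight_def normalized_aggregate_weight_def by simp

lemma weight_le_aggregate:
  assumes z: "z \<in> space configs" and i: "(m, k) \<in> particles M K"
  shows "snd z (m, k) \<le> aggregate_weight K z m"
  unfolding aggregate_weight_def
  using i weight_pos[OF z] by (intro member_le_sum) (auto simp: less_imp_le)

text \<open>A share is a quotient whose numerator grows by at most the factor \<open>A\<close> while
  its denominator shrinks by at most the same factor.\<close>

lemma max_weight_growth:
  assumes z: "z \<in> space configs"
    and w: "\<And>i. i \<in> particles M K \<Longrightarrow> snd z i / A \<le> snd z' i \<and> snd z' i \<le> A * snd z i"
  shows "max_weight z' \<le> A\<^sup>2 * max_weight z"
proof (rule max_weight_le)
  fix m assume m: "m \<in> {1..M}"
  have "aggregate_weight K z' m \<le> A * aggregate_weight K z m"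
    unfolding aggregate_weight_def sum_distrib_left using w m by (intro sum_mono) auto
  moreover have "total z / A \<le> total z'"
    unfolding total_def sum_divide_distrib using w by (intro sum_mono) auto
  ultimately have "aggregate_weight K z' m / total z' \<le> (A * aggregate_weight K z m) / (total z / A)"
    using total_pos[OF z] A aggregate_pos[OF z m] by (intro frac_le) auto
  also have "\<dots> = A\<^sup>2 * (aggregate_weight K z m / total z)" by (simp add: power2_eq_square)
  also have "\<dots> \<le> A\<^sup>2 * max_weight z" using max_weight_ge[OF m] by (intro mult_left_mono) auto
  finally show "aggregate_weight K z' m / total z' \<le> A\<^sup>2 * max_weight z" .
qed

text \<open>A particle weighs at most as much as its whole processing element. These are the
  conditions of \<open>sqrt_sum_squares_le\<close> with \<open>s = max_weight z\<close>.\<close>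

lemma normalized_weights:
  assumes z: "z \<in> space configs"
  shows "(\<Sum>i\<in>particles M K. snd z i / total z) = 1"
    and "i \<in> particles M K \<Longrightarrow> 0 \<le> snd z i / total z \<and> snd z i / total z \<le> max_weight z"
proof -
  show "(\<Sum>i\<in>particles M K. snd z i / total z) = 1"
    using total_pos[OF z] by (simp add: sum_divide_distrib[symmetric] total_def)
  assume i: "i \<in> particles M K"
  then obtain m k where mk: "i = (m, k)" "m \<in> {1..M}" by auto
  have "snd z i / total z \<le> aggregate_weight K z m / total z"
    using total_pos[OF z] weight_le_aggregate[OF z] i mk by (intro divide_right_mono) auto
  then show "0 \<le> snd z i / total z \<and> snd z i / total z \<le> max_weight z"
    using max_weight_ge[OF mk(2), of z] total_pos[OF z] weight_pos[OF z i] by auto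
qed

section \<open>One step of the optimal filter and of the sampling\<close>

text \<open>A bounded test function together with an explicit bound: all errors are tracked linearly
  in \<open>B\<close>, and \<open>push\<close> multiplies the bound by \<open>A\<close>.\<close>

definition bounded_by :: "real \<Rightarrow> ('x \<Rightarrow> real) \<Rightarrow> bool"
  where "bounded_by B h \<longleftrightarrow> h \<in> borel_measurable (borel_on X) \<and> (\<forall>x\<in>X. \<bar>h x\<bar> \<le> B)"

lemma bounded_byD:
  assumes "bounded_by B h"
  shows "h \<in> borel_measurable (borel_on X)" "x \<in> X \<Longrightarrow> \<bar>h x\<bar> \<le> B"
  using assms by (auto simp: bounded_by_def)

text \<open>The unnormalized Feynman-Kac operator acting on test functions. \<open>Psi\<close> is
  the quotient of its integrals at \<open>h\<close> and at the constant 1.\<close>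

definition push :: "nat \<Rightarrow> ('x \<Rightarrow> real) \<Rightarrow> 'x \<Rightarrow> real"
  where "push n h x = (\<integral>x'. h x' * G n x' \<partial>tau n x)"

lemma space_X: "space (borel_on X) = X"
  by (simp add: space_restrict_space)

lemma prob_measuresD:
  assumes "\<alpha> \<in> prob_measures_on X"
  shows "prob_space \<alpha>" "sets \<alpha> = sets (borel_on X)" "space \<alpha> = X"
  using assms sets_eq_imp_space_eq[of \<alpha> "borel_on X"]
  by (auto simp: prob_measures_on_def space_prob_algebra space_restrict_space)

lemma tau_in: "n \<ge> 1 \<Longrightarrow> x \<in> X \<Longrightarrow> tau n x \<in> prob_measures_on X"
  using measurable_space[OF tau, of n x] by (simp add: prob_measures_on_def space_X)

lemma measurable_on:
  fixes h :: "'x \<Rightarrow> real"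
  assumes "\<alpha> \<in> prob_measures_on X" and "h \<in> borel_measurable (borel_on X)"
  shows "h \<in> borel_measurable \<alpha>"
  using assms prob_measuresD(2)[OF assms(1)] by (simp cong: measurable_cong_sets)

lemma integrable_bounded_by:
  assumes \<alpha>: "\<alpha> \<in> prob_measures_on X" and h: "bounded_by B h"
  shows "integrable \<alpha> h"
proof -
  interpret prob_space \<alpha> by (rule prob_measuresD(1)[OF \<alpha>])
  show ?thesis
  proof (rule integrable_const_bound)
    show "AE x in \<alpha>. norm (h x) \<le> B"
      using h by (intro AE_I2) (simp add: bounded_by_def prob_measuresD(3)[OF \<alpha>])
    show "h \<in> borel_measurable \<alpha>"
      by (rule measurable_on[OF \<alpha> bounded_byD(1)[OF h]])
  qed
qed

lemma abs_integral_le: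
  assumes \<alpha>: "\<alpha> \<in> prob_measures_on X" and h: "bounded_by B h"
  shows "\<bar>\<integral>x. h x \<partial>\<alpha>\<bar> \<le> B"
proof -
  interpret prob_space \<alpha> by (rule prob_measuresD(1)[OF \<alpha>])
  have "\<bar>\<integral>x. h x \<partial>\<alpha>\<bar> \<le> (\<integral>x. \<bar>h x\<bar> \<partial>\<alpha>)" by (rule integral_abs_bound)
  also have "\<dots> \<le> B"
    using h by (intro integral_le_const AE_I2 integrable_abs integrable_bounded_by[OF \<alpha> h])
      (simp add: bounded_by_def prob_measuresD(3)[OF \<alpha>])
  finally show ?thesis .
qed

text \<open>\<open>X\<close> carries the probability measure \<open>tau0\<close>, so it has a point
  and the bound cannot be negative.\<close>

lemma bounded_by_nonneg: "bounded_by B h \<Longrightarrow> 0 \<le> B"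
  using abs_integral_le[OF tau0, of B h] by linarith

lemma bounded_by_1: "bounded_by 1 (\<lambda>_. 1)"
  by (simp add: bounded_by_def)

lemma bounded_by_G:
  assumes "n \<ge> 1" "bounded_by B h"
  shows "bounded_by (A * B) (\<lambda>x. h x * G n x)"
  unfolding bounded_by_def
proof safe
  fix x assume x: "x \<in> X"
  have "\<bar>h x\<bar> \<le> B" "\<bar>G n x\<bar> \<le> A"
    using assms x G_bounds[of n x] G_pos[of n x] by (auto simp: bounded_by_def)
  then show "\<bar>h x * G n x\<bar> \<le> A * B"
    using mult_mono'[of "\<bar>G n x\<bar>" A "\<bar>h x\<bar>" B] by (simp add: abs_mult mult.commute)
qed (use assms G in \<open>auto simp: bounded_by_def\<close>)

lemma bounded_by_push:
  assumes n: "n \<ge> 1" and h: "bounded_by B h"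
  shows "bounded_by (A * B) (push n h)"
  unfolding bounded_by_def
proof safe
  note hG = bounded_by_G[OF n h]
  show "push n h \<in> borel_measurable (borel_on X)"
    unfolding push_def[abs_def]
    using hG by (intro measurable_compose[OF measurable_prob_algebraD[OF tau[OF n]]]
        integral_measurable_subprob_algebra) (auto simp: bounded_by_def)
  show "\<bar>push n h x\<bar> \<le> A * B" if "x \<in> X" for x
    unfolding push_def by (rule abs_integral_le[OF tau_in[OF n that] hG])
qed

text \<open>The lower likelihood bound survives averaging over probability measures, which keeps the
  normalizing constants of \<open>Psi\<close> away from zero.\<close>

lemma push_1_ge:
  assumes n: "n \<ge> 1" and \<alpha>: "\<alpha> \<in> prob_measures_on X"
  shows "1 / A \<le> (\<integral>x. push n (\<lambda>_. 1) x \<partial>\<alpha>)"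
proof -
  have ge: "1 / A \<le> push n (\<lambda>_. 1) x" if x: "x \<in> X" for x
  proof -
    note t = tau_in[OF n x]
    interpret prob_space "tau n x" using prob_measuresD[OF t] by simp
    show ?thesis
      unfolding push_def using G_bounds[OF n] prob_measuresD(3)[OF t]
      by (intro integral_ge_const integrable_bounded_by[OF t bounded_by_G[OF n bounded_by_1]] AE_I2) auto
  qed
  interpret prob_space \<alpha> by (rule prob_measuresD(1)[OF \<alpha>])
  show ?thesis
    using ge prob_measuresD(3)[OF \<alpha>]
    by (intro integral_ge_const integrable_bounded_by[OF \<alpha> bounded_by_push[OF n bounded_by_1]] AE_I2) auto
qed

lemma bounded_by_functions: "bounded_by B h \<Longrightarrow> h \<in> bounded_functions X"
  by (auto simp: bounded_by_def bounded_functions_def bounded_iff)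

lemma Psi_in:
  assumes n: "n \<ge> 1" and \<alpha>: "\<alpha> \<in> prob_measures_on X"
  shows "Psi tau G n \<alpha> \<in> prob_measures_on X"
  using A G_bounds[OF n]
  by (intro integral_Psi(1)[where l="1/A" and u=A and h="\<lambda>_. 1"] \<alpha> tau[OF n] G[OF n]
      bounded_by_functions[OF bounded_by_1]) auto

lemma integral_Psi_push:
  assumes n: "n \<ge> 1" and \<alpha>: "\<alpha> \<in> prob_measures_on X" and h: "bounded_by B h"
  shows "(\<integral>x. h x \<partial>Psi tau G n \<alpha>) = (\<integral>x. push n h x \<partial>\<alpha>) / (\<integral>x. push n (\<lambda>_. 1) x \<partial>\<alpha>)"
proof -
  have "(\<integral>x. h x \<partial>Psi tau G n \<alpha>) =
      (\<integral>x. (\<integral>x'. h x' * G n x' \<partial>tau n x) \<partial>\<alpha>) / (\<integral>x. (\<integral>x'. G n x' \<partial>tau n x) \<partial>\<alpha>)"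
    using A G_bounds[OF n]
    by (intro integral_Psi(2)[where l="1/A" and u=A and X=X] \<alpha> tau[OF n] G[OF n] bounded_by_functions[OF h]) auto
  then show ?thesis by (simp add: push_def)
qed

text \<open>Lipschitz continuity in a weak sense: the difference at \<open>h\<close> is controlled
  by differences at two other test functions, \<open>push n h\<close> and the \<open>push\<close> of
  1. Inductions along the flow must therefore range over all bounded test functions at once.\<close>

lemma Psi_diff_le:
  assumes n: "n \<ge> 1" and \<alpha>: "\<alpha> \<in> prob_measures_on X" and \<eta>: "\<eta> \<in> prob_measures_on X"
    and h: "bounded_by B h"
  shows "\<bar>(\<integral>x. h x \<partial>Psi tau G n \<alpha>) - (\<integral>x. h x \<partial>Psi tau G n \<eta>)\<bar>
    \<le> A * (\<bar>(\<integral>x. push n h x \<partial>\<alpha>) - (\<integral>x. push n h x \<partial>\<eta>)\<bar>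
      + B * \<bar>(\<integral>x. push n (\<lambda>_. 1) x \<partial>\<alpha>) - (\<integral>x. push n (\<lambda>_. 1) x \<partial>\<eta>)\<bar>)"
  unfolding integral_Psi_push[OF n \<alpha> h] integral_Psi_push[OF n \<eta> h]
proof (rule abs_ratio_diff_le)
  show "0 < (\<integral>x. push n (\<lambda>_. 1) x \<partial>\<eta>)"
    using push_1_ge[OF n \<eta>] A by (auto intro: less_le_trans[of 0 "1 / A"])
  show "\<bar>(\<integral>x. push n h x \<partial>\<eta>) / (\<integral>x. push n (\<lambda>_. 1) x \<partial>\<eta>)\<bar> \<le> B"
    using abs_integral_le[OF Psi_in[OF n \<eta>] h] by (simp add: integral_Psi_push[OF n \<eta> h])
qed (use A push_1_ge[OF n \<alpha>] in auto)

section \<open>Sampling and reweighting of the particles\<close>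

abbreviation "propagated n z \<equiv> PiM (particles M K) (\<lambda>i. tau n (fst z i))"

definition reweighted :: "nat \<Rightarrow> 'x config \<Rightarrow> (nat \<times> nat \<Rightarrow> 'x) \<Rightarrow> 'x config"
  where "reweighted n z x = (x, \<lambda>i\<in>particles M K. snd z i * G n (x i))"

lemma propagated_in:
  assumes n: "n \<ge> 1" and z: "z \<in> space configs"
  shows "prob_space (propagated n z)" "sets (propagated n z) = sets (PiM (particles M K) (\<lambda>_. borel_on X))"
  using prob_measuresD[OF tau_in[OF n state_in[OF z]]]
  by (auto intro!: prob_space_PiM sets_PiM_cong)

lemma propagated_mem:
  assumes n: "n \<ge> 1" and z: "z \<in> space configs" and x: "x \<in> space (propagated n z)" and i: "i \<in> particles M K"
  shows "x i \<in> X"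
  using x i prob_measuresD(3)[OF tau_in[OF n state_in[OF z i]]] by (auto simp: space_PiM PiE_iff)

lemma reweighted_measurable:
  assumes n: "n \<ge> 1" and z: "z \<in> space configs"
  shows "reweighted n z \<in> propagated n z \<rightarrow>\<^sub>M configs"
proof -
  have G': "(\<lambda>x. snd z i * G n (x i)) \<in> propagated n z \<rightarrow>\<^sub>M borel_on {0<..}" if i: "i \<in> particles M K" for i
  proof (rule measurable_restrict_space2)
    show "(\<lambda>x. snd z i * G n (x i)) \<in> space (propagated n z) \<rightarrow> {0<..}"
      using weight_pos[OF z i] G_pos[OF n propagated_mem[OF n z _ i]] by auto
    show "(\<lambda>x. snd z i * G n (x i)) \<in> borel_measurable (propagated n z)"
      by (intro borel_measurable_times borel_measurable_const measurable_PiM_component_rev[OF i]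
          measurable_on[OF tau_in[OF n state_in[OF z i]] G[OF n]])
  qed
  show ?thesis
    unfolding reweighted_def[abs_def] config_space_def
    using G' propagated_in(2)[OF n z]
    by (intro measurable_Pair measurable_ident_sets measurable_restrict) auto
qed

lemma dpf_sample_eq: "dpf_sample X tau G M K n z = distr (propagated n z) configs (reweighted n z)"
  by (simp add: dpf_sample_def reweighted_def[abs_def])

text \<open>The new estimate is a quotient of two weighted averages of independent variables, and
  \<open>Psi\<close> applied to the old estimate is the quotient of their means.
  \<open>PiM_deviation\<close> handles numerator and denominator separately, and
  \<open>abs_ratio_diff_le\<close> combines them.\<close>

lemma sample_error:
  assumes n: "n \<ge> 1" and z: "z \<in> space configs" and h: "bounded_by B h"
  shows "(\<integral>\<^sup>+x. ennreal \<bar>(\<integral>u. h u \<partial>estimate (reweighted n z x)) - (\<integral>u. h u \<partial>Psi tau G n (estimate z))\<bar> \<partial>propagated n z)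
    \<le> ennreal (2 * A\<^sup>2 * B * sqrt (max_weight z))"
proof -
  define p where "p i = snd z i / total z" for i
  define N where "N f x = (\<Sum>i\<in>particles M K. p i * (f (x i) * G n (x i)))" for f :: "'x \<Rightarrow> real" and x
  have hm: "h \<in> borel_measurable (borel_on X)" using h by (simp add: bounded_by_def)
  have B0: "0 \<le> B" using bounded_by_nonneg[OF h] .
  note psum = normalized_weights[OF z, folded p_def]
  \<comment> \<open>The right-hand side is the mean of \<open>N f\<close>, which makes the
    deviations below centred sums.\<close>
  have ez: "(\<integral>u. push n f u \<partial>estimate z) = (\<Sum>i\<in>particles M K. p i * (\<integral>u. f u * G n u \<partial>tau n (fst z i)))"
    if "bounded_by b f" for b f
    using integral_estimate[OF z, of "push n f"] bounded_by_push[OF n that]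
    by (simp add: bounded_by_def p_def push_def)
  \<comment> \<open>Numerator and denominator share the factor \<open>total z\<close>, so the
    unnormalized weights may be replaced by the normalized ones.\<close>
  have ratio: "(\<integral>u. h u \<partial>estimate (reweighted n z x)) = N h x / N (\<lambda>_. 1) x"
    if x: "x \<in> space (propagated n z)" for x
  proof -
    have r: "reweighted n z x \<in> space configs" using measurable_space[OF reweighted_measurable[OF n z] x] .
    have "total (reweighted n z x) = total z * N (\<lambda>_. 1) x"
      using total_pos[OF z] unfolding N_def p_def sum_distrib_left
      by (auto simp: total_def reweighted_def intro!: sum.cong)
    moreover have "(\<Sum>i\<in>particles M K. snd z i * (h (x i) * G n (x i))) = total z * N h x"
      using total_pos[OF z] unfolding N_def p_def sum_distrib_left
      by (auto intro!: sum.cong)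
    moreover have "(\<integral>u. h u \<partial>estimate (reweighted n z x))
        = (\<Sum>i\<in>particles M K. snd z i * (h (x i) * G n (x i))) / total (reweighted n z x)"
      unfolding integral_estimate[OF r hm] sum_divide_distrib
      by (intro sum.cong) (auto simp: reweighted_def mult_ac)
    ultimately show ?thesis using total_pos[OF z] by simp
  qed
  have N1: "1 / A \<le> N (\<lambda>_. 1) x" if x: "x \<in> space (propagated n z)" for x
  proof -
    have "(\<Sum>i\<in>particles M K. p i * (1 / A)) \<le> N (\<lambda>_. 1) x"
      unfolding N_def using psum(2) G_bounds[OF n propagated_mem[OF n z x]]
      by (intro sum_mono mult_left_mono) auto
    then show ?thesis using psum(1) by (simp add: sum_divide_distrib[symmetric])
  qed
  have dev: "(\<integral>\<^sup>+x. ennreal \<bar>N f x - (\<integral>u. push n f u \<partial>estimate z)\<bar> \<partial>propagated n z)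
      \<le> ennreal (A * b * sqrt (max_weight z))" if f: "bounded_by b f" for f b
  proof -
    have "(\<integral>\<^sup>+x. ennreal \<bar>N f x - (\<integral>u. push n f u \<partial>estimate z)\<bar> \<partial>propagated n z)
      = (\<integral>\<^sup>+x. ennreal \<bar>\<Sum>i\<in>particles M K. p i * (f (x i) * G n (x i) - (\<integral>u. f u * G n u \<partial>tau n (fst z i)))\<bar> \<partial>propagated n z)"
      unfolding ez[OF f] N_def by (simp add: sum_subtractf right_diff_distrib)
    also have "\<dots> \<le> ennreal (sqrt (\<Sum>i\<in>particles M K. (p i)\<^sup>2 * (A * b)\<^sup>2))"
    proof (rule PiM_deviation)
      fix i assume i: "i \<in> particles M K"
      note t = tau_in[OF n state_in[OF z i]]
      show "prob_space (tau n (fst z i))" using prob_measuresD[OF t] by simp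
      show "(\<lambda>u. f u * G n u) \<in> borel_measurable (tau n (fst z i))"
        by (rule measurable_on[OF t bounded_byD(1)[OF bounded_by_G[OF n f]]])
      show "\<bar>f u * G n u\<bar> \<le> A * b" if "u \<in> space (tau n (fst z i))" for u
        using bounded_by_G[OF n f] that prob_measuresD(3)[OF t] by (simp add: bounded_by_def)
    qed simp
    also have "\<dots> \<le> ennreal (\<bar>A * b\<bar> * sqrt (max_weight z))"
      using psum by (intro ennreal_leI sqrt_sum_squares_le) auto
    finally show ?thesis using A bounded_by_nonneg[OF f] by simp
  qed
  have Nm: "N f \<in> borel_measurable (propagated n z)" if f: "bounded_by b f" for f b
    unfolding N_def[abs_def]
  proof (rule borel_measurable_sum)
    fix i assume i: "i \<in> particles M K"
    note t = tau_in[OF n state_in[OF z i]]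
    have "(\<lambda>x. f (x i)) \<in> borel_measurable (propagated n z)"
      by (rule measurable_PiM_component_rev[OF i], rule measurable_on[OF t bounded_byD(1)[OF f]])
    moreover have "(\<lambda>x. G n (x i)) \<in> borel_measurable (propagated n z)"
      by (rule measurable_PiM_component_rev[OF i], rule measurable_on[OF t G[OF n]])
    ultimately show "(\<lambda>x. p i * (f (x i) * G n (x i))) \<in> borel_measurable (propagated n z)"
      by (intro borel_measurable_times borel_measurable_const)
  qed
  let ?d = "\<lambda>f x. N f x - (\<integral>u. push n f u \<partial>estimate z)"
  have "(\<integral>\<^sup>+x. ennreal \<bar>(\<integral>u. h u \<partial>estimate (reweighted n z x)) - (\<integral>u. h u \<partial>Psi tau G n (estimate z))\<bar> \<partial>propagated n z)
      \<le> (\<integral>\<^sup>+x. ennreal A * (ennreal \<bar>?d h x\<bar> + ennreal B * ennreal \<bar>?d (\<lambda>_. 1) x\<bar>) \<partial>propagated n z)"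
  proof (rule nn_integral_mono)
    fix x assume x: "x \<in> space (propagated n z)"
    have "\<bar>(\<integral>u. h u \<partial>estimate (reweighted n z x)) - (\<integral>u. h u \<partial>Psi tau G n (estimate z))\<bar>
      \<le> A * (\<bar>?d h x\<bar> + B * \<bar>?d (\<lambda>_. 1) x\<bar>)"
      unfolding ratio[OF x] integral_Psi_push[OF n estimate_in[OF z] h]
    proof (rule abs_ratio_diff_le)
      show "0 < (\<integral>u. push n (\<lambda>_. 1) u \<partial>estimate z)"
        using push_1_ge[OF n estimate_in[OF z]] A by (auto intro: less_le_trans[of 0 "1 / A"])
      show "\<bar>(\<integral>u. push n h u \<partial>estimate z) / (\<integral>u. push n (\<lambda>_. 1) u \<partial>estimate z)\<bar> \<le> B"
        using abs_integral_le[OF Psi_in[OF n estimate_in[OF z]] h]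
        by (simp add: integral_Psi_push[OF n estimate_in[OF z] h])
    qed (use A N1[OF x] in auto)
    then show "ennreal \<bar>(\<integral>u. h u \<partial>estimate (reweighted n z x)) - (\<integral>u. h u \<partial>Psi tau G n (estimate z))\<bar>
      \<le> ennreal A * (ennreal \<bar>?d h x\<bar> + ennreal B * ennreal \<bar>?d (\<lambda>_. 1) x\<bar>)"
      using A B0 by (simp flip: ennreal_mult ennreal_plus)
  qed
  also have "\<dots> = ennreal A * ((\<integral>\<^sup>+x. ennreal \<bar>?d h x\<bar> \<partial>propagated n z)
      + ennreal B * (\<integral>\<^sup>+x. ennreal \<bar>?d (\<lambda>_. 1) x\<bar> \<partial>propagated n z))"
    using Nm[OF h] Nm[OF bounded_by_1] by (subst nn_integral_cmult | subst nn_integral_add | simp)+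
  also have "\<dots> \<le> ennreal A * (ennreal (A * B * sqrt (max_weight z)) + ennreal B * ennreal (A * 1 * sqrt (max_weight z)))"
    using dev[OF h] dev[OF bounded_by_1] by (intro mult_left_mono add_mono) auto
  \<comment> \<open>Numerator and denominator contribute
    \<open>A\<^sup>2 * B * sqrt (max_weight z)\<close> each.\<close>
  also have "\<dots> = ennreal (2 * A\<^sup>2 * B * sqrt (max_weight z))"
    using A B0 max_weight_pos[OF z] by (simp flip: ennreal_mult ennreal_plus add: power2_eq_square distrib_left mult_ac)
  finally show ?thesis .
qed

lemma max_weight_reweighted:
  assumes n: "n \<ge> 1" and z: "z \<in> space configs" and x: "x \<in> space (propagated n z)"
  shows "max_weight (reweighted n z x) \<le> A\<^sup>2 * max_weight z"
proof (rule max_weight_growth[OF z])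
  fix i assume i: "i \<in> particles M K"
  have g: "1 / A \<le> G n (x i)" "G n (x i) \<le> A"
    using G_bounds[OF n propagated_mem[OF n z x i]] by auto
  have "snd z i * (1 / A) \<le> snd z i * G n (x i)" "snd z i * G n (x i) \<le> snd z i * A"
    using g weight_pos[OF z i] by (intro mult_left_mono; simp)+
  moreover have "snd (reweighted n z x) i = snd z i * G n (x i)"
    using i by (simp add: reweighted_def)
  ultimately show "snd z i / A \<le> snd (reweighted n z x) i \<and> snd (reweighted n z x) i \<le> A * snd z i"
    by (simp add: mult.commute)
qed

section \<open>Resampling and exchange\<close>

abbreviation local_measure :: "'x config \<Rightarrow> nat \<Rightarrow> 'x measure"
  where "local_measure z m \<equiv> weighted_diracs (borel_on X) {1..K}
    (\<lambda>j. snd z (m, j) / aggregate_weight K z m) (\<lambda>j. fst z (m, j))"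

abbreviation "selection z \<equiv> PiM (particles M K) (\<lambda>i. local_measure z (fst i))"

definition resampled :: "'x config \<Rightarrow> (nat \<times> nat \<Rightarrow> 'x) \<Rightarrow> 'x config"
  where "resampled z x = (x, \<lambda>i\<in>particles M K. aggregate_weight K z (fst i) / real K)"

lemma local_measure_in:
  assumes z: "z \<in> space configs" and m: "m \<in> {1..M}"
  shows "local_measure z m \<in> prob_measures_on X"
proof -
  have "prob_space (local_measure z m)"
  proof (rule prob_space_weighted_diracs)
    show "(\<Sum>j\<in>{1..K}. snd z (m, j) / aggregate_weight K z m) = 1"
      unfolding sum_divide_distrib[symmetric] aggregate_weight_def[symmetric]
      using aggregate_pos[OF z m] by simp
  next
    fix j assume "j \<in> {1..K}"
    then have i: "(m, j) \<in> particles M K" using m by simp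
    show "0 \<le> snd z (m, j) / aggregate_weight K z m"
      using weight_pos[OF z i] aggregate_pos[OF z m] by simp
    show "fst z (m, j) \<in> space (borel_on X)"
      using state_in[OF z i] by (simp add: space_X)
  qed simp
  then show ?thesis
    by (simp add: prob_measures_on_def space_prob_algebra weighted_diracs_def)
qed

text \<open>Local resampling is unbiased in each processing element. The aggregate weight is
  multiplied out because it is what the resampled particles share equally.\<close>

lemma integral_local_measure:
  fixes h :: "'x \<Rightarrow> real"
  assumes z: "z \<in> space configs" and m: "m \<in> {1..M}" and h: "h \<in> borel_measurable (borel_on X)"
  shows "aggregate_weight K z m * (\<integral>u. h u \<partial>local_measure z m) = (\<Sum>j\<in>{1..K}. snd z (m, j) * h (fst z (m, j)))"
proof -
  have "(\<integral>u. h u \<partial>local_measure z m) = (\<Sum>j\<in>{1..K}. snd z (m, j) / aggregate_weight K z m * h (fst z (m, j)))"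
  proof (rule integral_weighted_diracs[OF _ _ _ h])
    fix j assume "j \<in> {1..K}"
    then have i: "(m, j) \<in> particles M K" using m by simp
    show "0 \<le> snd z (m, j) / aggregate_weight K z m"
      using weight_pos[OF z i] aggregate_pos[OF z m] by simp
    show "fst z (m, j) \<in> space (borel_on X)"
      using state_in[OF z i] by (simp add: space_X)
  qed simp
  then show ?thesis using aggregate_pos[OF z m] by (simp add: sum_distrib_left)
qed

lemma selection_in:
  assumes z: "z \<in> space configs"
  shows "prob_space (selection z)" "sets (selection z) = sets (PiM (particles M K) (\<lambda>_. borel_on X))"
proof -
  have *: "local_measure z (fst i) \<in> prob_measures_on X" if "i \<in> particles M K" for i
    using that by (intro local_measure_in[OF z]) auto
  show "prob_space (selection z)"
    using prob_measuresD(1)[OF *] by (intro prob_space_PiM)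
  show "sets (selection z) = sets (PiM (particles M K) (\<lambda>_. borel_on X))"
    using prob_measuresD(2)[OF *] by (intro sets_PiM_cong refl)
qed

lemma resampled_measurable:
  assumes z: "z \<in> space configs"
  shows "resampled z \<in> selection z \<rightarrow>\<^sub>M configs"
  unfolding resampled_def[abs_def] config_space_def
proof (intro measurable_Pair measurable_ident_sets measurable_restrict selection_in(2)[OF z] measurable_const)
  fix i assume "i \<in> particles M K"
  then have "fst i \<in> {1..M}" by auto
  from aggregate_pos[OF z this] K
  show "aggregate_weight K z (fst i) / real K \<in> space (borel_on {0<..})"
    by (simp add: space_restrict_space)
qed

lemma dpf_resample_eq: "dpf_resample X M K z = distr (selection z) configs (resampled z)"
  by (simp add: dpf_resample_def resampled_def[abs_def] case_prod_beta')

text \<open>Hence local resampling leaves \<open>max_weight\<close> unchanged; it can move only by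
  reweighting and by exchange.\<close>

lemma aggregate_resampled:
  assumes m: "m \<in> {1..M}"
  shows "aggregate_weight K (resampled z x) m = aggregate_weight K z m"
proof -
  have "aggregate_weight K (resampled z x) m = (\<Sum>k\<in>{1..K}. aggregate_weight K z m / real K)"
    unfolding aggregate_weight_def[of K "resampled z x"]
    using m by (intro sum.cong) (auto simp: resampled_def)
  also have "\<dots> = aggregate_weight K z m" using K by simp
  finally show ?thesis .
qed

lemma total_resampled: "total (resampled z x) = total z"
  unfolding sum_aggregate[symmetric] by (intro sum.cong refl aggregate_resampled)

text \<open>Given \<open>z\<close>, the new particles are independent with the local measures as
  laws, their weighted mean is the old estimate, and each carries a K-th of the share of its
  processing element. This is again the situation of \<open>PiM_deviation\<close>.\<close>

lemma resample_error:
  assumes z: "z \<in> space configs" and h: "bounded_by B h"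
  shows "(\<integral>\<^sup>+x. ennreal \<bar>(\<integral>u. h u \<partial>estimate (resampled z x)) - (\<integral>u. h u \<partial>estimate z)\<bar> \<partial>selection z)
    \<le> ennreal (B * sqrt (max_weight z))"
proof -
  note hm = bounded_byD(1)[OF h]
  define p where "p i = aggregate_weight K z (fst i) / real K / total z" for i :: "nat \<times> nat"
  have p_le: "0 \<le> p i \<and> p i \<le> max_weight z" if "i \<in> particles M K" for i
  proof -
    have m: "fst i \<in> {1..M}" using that by auto
    have "aggregate_weight K z (fst i) / real K \<le> aggregate_weight K z (fst i)"
      using K aggregate_pos[OF z m] by (simp add: divide_le_eq)
    then have "p i \<le> aggregate_weight K z (fst i) / total z"
      unfolding p_def using total_pos[OF z] by (intro divide_right_mono) auto
    then show ?thesis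
      using max_weight_ge[OF m, of z] aggregate_pos[OF z m] total_pos[OF z] by (auto simp: p_def)
  qed
  \<comment> \<open>The particles of one processing element have equal weights and the same law, so
    sums over particles collapse to sums over processing elements.\<close>
  have p_sum: "(\<Sum>i\<in>particles M K. p i * f (fst i)) = (\<Sum>m\<in>{1..M}. aggregate_weight K z m * f m) / total z" for f
  proof -
    have "(\<Sum>i\<in>particles M K. p i * f (fst i)) = (\<Sum>m\<in>{1..M}. \<Sum>k\<in>{1..K}. p (m, k) * f m)"
      by (simp add: sum.cartesian_product case_prod_beta')
    also have "\<dots> = (\<Sum>m\<in>{1..M}. aggregate_weight K z m * f m / total z)"
      using K by (intro sum.cong) (auto simp: p_def)
    finally show ?thesis by (simp add: sum_divide_distrib)
  qed
  have p1: "(\<Sum>i\<in>particles M K. p i) = 1"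
    using p_sum[of "\<lambda>_. 1"] total_pos[OF z] by (simp only: sum_aggregate mult_1_right) simp
  have ez: "(\<integral>u. h u \<partial>estimate z) = (\<Sum>i\<in>particles M K. p i * (\<integral>u. h u \<partial>local_measure z (fst i)))"
  proof -
    have "(\<Sum>i\<in>particles M K. p i * (\<integral>u. h u \<partial>local_measure z (fst i)))
      = (\<Sum>m\<in>{1..M}. \<Sum>k\<in>{1..K}. snd z (m, k) * h (fst z (m, k))) / total z"
      unfolding p_sum[of "\<lambda>m. \<integral>u. h u \<partial>local_measure z m"]
      by (intro arg_cong2[where f="(/)"] sum.cong refl integral_local_measure[OF z _ hm])
    also have "\<dots> = (\<Sum>i\<in>particles M K. snd z i * h (fst z i)) / total z"
      by (simp add: sum.cartesian_product case_prod_beta')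
    also have "\<dots> = (\<integral>u. h u \<partial>estimate z)"
      unfolding integral_estimate[OF z hm] by (simp add: sum_divide_distrib)
    finally show ?thesis by simp
  qed
  have er: "(\<integral>u. h u \<partial>estimate (resampled z x)) = (\<Sum>i\<in>particles M K. p i * h (x i))"
    if x: "x \<in> space (selection z)" for x
    using integral_estimate[OF measurable_space[OF resampled_measurable[OF z] x] hm]
    by (simp add: total_resampled p_def) (simp add: resampled_def)
  have "(\<integral>\<^sup>+x. ennreal \<bar>(\<integral>u. h u \<partial>estimate (resampled z x)) - (\<integral>u. h u \<partial>estimate z)\<bar> \<partial>selection z)
    = (\<integral>\<^sup>+x. ennreal \<bar>\<Sum>i\<in>particles M K. p i * (h (x i) - (\<integral>u. h u \<partial>local_measure z (fst i)))\<bar> \<partial>selection z)"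
    by (intro nn_integral_cong) (simp add: er ez sum_subtractf right_diff_distrib)
  also have "\<dots> \<le> ennreal (sqrt (\<Sum>i\<in>particles M K. (p i)\<^sup>2 * B\<^sup>2))"
  proof (rule PiM_deviation)
    fix i assume "i \<in> particles M K"
    then have "fst i \<in> {1..M}" by auto
    note t = local_measure_in[OF z this]
    show "prob_space (local_measure z (fst i))" by (rule prob_measuresD(1)[OF t])
    show "h \<in> borel_measurable (local_measure z (fst i))" by (rule measurable_on[OF t hm])
    show "\<bar>h u\<bar> \<le> B" if "u \<in> space (local_measure z (fst i))" for u
      using bounded_byD(2)[OF h] that prob_measuresD(3)[OF t] by simp
  qed simp
  also have "\<dots> \<le> ennreal (\<bar>B\<bar> * sqrt (max_weight z))"
    using p_le p1 by (intro ennreal_leI sqrt_sum_squares_le) auto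
  finally show ?thesis using bounded_by_nonneg[OF h] by simp
qed

section \<open>Exchange and the complete step\<close>

abbreviation "exchange \<equiv> dpf_exchange M K n0 \<beta>"

text \<open>The exchange permutes the particles together with their weights, which only reorders the
  sum behind the estimate. What it does affect is the aggregate weights, and so
  \<open>max_weight\<close>.\<close>

lemma estimate_exchange:
  fixes h :: "'x \<Rightarrow> real"
  assumes z: "z \<in> space configs" and h: "h \<in> borel_measurable (borel_on X)"
  shows "(\<integral>u. h u \<partial>estimate (exchange n z)) = (\<integral>u. h u \<partial>estimate z)"
proof (cases "n0 dvd n")
  case True
  let ?i = "inv_into (particles M K) \<beta>"
  have bij: "bij_betw ?i (particles M K) (particles M K)" by (rule bij_betw_inv_into[OF \<beta>])
  have e: "fst (exchange n z) i = fst z (?i i)" "snd (exchange n z) i = snd z (?i i)"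
    if "i \<in> particles M K" for i
    using True that by (simp_all add: dpf_exchange_def)
  have "total (exchange n z) = (\<Sum>i\<in>particles M K. snd z (?i i))"
    unfolding total_def using e by (intro sum.cong) auto
  also have "\<dots> = total z" unfolding total_def by (rule sum.reindex_bij_betw[OF bij])
  finally have t: "total (exchange n z) = total z" .
  have "(\<integral>u. h u \<partial>estimate (exchange n z)) = (\<Sum>i\<in>particles M K. snd z (?i i) / total z * h (fst z (?i i)))"
    unfolding integral_estimate[OF measurable_space[OF exchange_measurable z] h] t
    using e by (intro sum.cong) auto
  also have "\<dots> = (\<Sum>i\<in>particles M K. snd z i / total z * h (fst z i))"
    by (rule sum.reindex_bij_betw[OF bij])
  finally show ?thesis by (simp only: integral_estimate[OF z h])
qed (simp add: dpf_exchange_def)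

text \<open>Displays the two draws of a step as iterated integrals, so that the resampling error can
  be estimated conditionally on the outcome of the sampling.\<close>

lemma nn_integral_step:
  assumes n: "n \<ge> 1" and z: "z \<in> space configs" and f: "f \<in> borel_measurable configs"
  shows "(\<integral>\<^sup>+z'. f z' \<partial>step n z) = (\<integral>\<^sup>+x. (\<integral>\<^sup>+x'. f (exchange n (resampled (reweighted n z x) x'))
    \<partial>selection (reweighted n z x)) \<partial>propagated n z)"
proof -
  let ?k = "\<lambda>c. distr (dpf_resample X M K c) configs (exchange n)"
  have k: "?k \<in> configs \<rightarrow>\<^sub>M subprob_algebra configs"
    by (intro measurable_prob_algebraD
        measurable_compose[OF resample_measurable measurable_distr_prob_space[OF exchange_measurable]])
  have fk: "(\<lambda>c. \<integral>\<^sup>+z'. f z' \<partial>?k c) \<in> borel_measurable configs"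
    by (rule measurable_compose[OF k nn_integral_measurable_subprob_algebra[OF f]])
  have "(\<integral>\<^sup>+z'. f z' \<partial>step n z) = (\<integral>\<^sup>+c. (\<integral>\<^sup>+z'. f z' \<partial>?k c) \<partial>dpf_sample X tau G M K n z)"
    unfolding dpf_step_def
  proof (rule nn_integral_bind[OF f])
    show "?k \<in> dpf_sample X tau G M K n z \<rightarrow>\<^sub>M subprob_algebra configs"
      using k by (simp add: dpf_sample_eq cong: measurable_cong_sets)
  qed
  also have "\<dots> = (\<integral>\<^sup>+x. (\<integral>\<^sup>+z'. f z' \<partial>?k (reweighted n z x)) \<partial>propagated n z)"
    unfolding dpf_sample_eq by (rule nn_integral_distr[OF reweighted_measurable[OF n z]]) (simp add: fk)
  also have "\<dots> = (\<integral>\<^sup>+x. (\<integral>\<^sup>+x'. f (exchange n (resampled (reweighted n z x) x'))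
    \<partial>selection (reweighted n z x)) \<partial>propagated n z)"
  proof (rule nn_integral_cong)
    fix x assume "x \<in> space (propagated n z)"
    then have r: "reweighted n z x \<in> space configs" by (rule measurable_space[OF reweighted_measurable[OF n z]])
    have "(\<integral>\<^sup>+z'. f z' \<partial>?k (reweighted n z x)) = (\<integral>\<^sup>+z'. f (exchange n z') \<partial>dpf_resample X M K (reweighted n z x))"
      using exchange_measurable by (intro nn_integral_distr) (simp_all add: f dpf_resample_eq cong: measurable_cong_sets)
    also have "\<dots> = (\<integral>\<^sup>+x'. f (exchange n (resampled (reweighted n z x) x')) \<partial>selection (reweighted n z x))"
      unfolding dpf_resample_eq
      by (rule nn_integral_distr[OF resampled_measurable[OF r]])
        (simp add: measurable_compose[OF exchange_measurable f])
    finally show "(\<integral>\<^sup>+z'. f z' \<partial>?k (reweighted n z x)) =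
      (\<integral>\<^sup>+x'. f (exchange n (resampled (reweighted n z x) x')) \<partial>selection (reweighted n z x))" .
  qed
  finally show ?thesis .
qed

text \<open>Triangle inequality through the estimate of the reweighted configuration:
  \<open>resample_error\<close> bounds one side, \<open>sample_error\<close> the other, and the
  exchange has no effect.\<close>

lemma step_error:
  assumes n: "n \<ge> 1" and z: "z \<in> space configs" and h: "bounded_by B h"
  shows "(\<integral>\<^sup>+z'. ennreal \<bar>(\<integral>u. h u \<partial>estimate z') - (\<integral>u. h u \<partial>Psi tau G n (estimate z))\<bar> \<partial>step n z)
    \<le> ennreal (3 * A\<^sup>2 * B * sqrt (max_weight z))"
proof -
  note hm = bounded_byD(1)[OF h] and B0 = bounded_by_nonneg[OF h]
  note em = estimate_measurable[OF hm]
  define t where "t = (\<integral>u. h u \<partial>Psi tau G n (estimate z))"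
  let ?e = "\<lambda>z. \<integral>u. h u \<partial>estimate z"
  interpret P: prob_space "propagated n z" by (rule propagated_in(1)[OF n z])
  have em': "(\<lambda>z. ennreal \<bar>?e z - s\<bar>) \<in> borel_measurable configs" for s
    by (intro measurable_compose[OF _ measurable_ennreal] borel_measurable_abs borel_measurable_diff em borel_measurable_const)
  have "(\<integral>\<^sup>+z'. ennreal \<bar>?e z' - t\<bar> \<partial>step n z) = (\<integral>\<^sup>+x. (\<integral>\<^sup>+x'. ennreal \<bar>?e (exchange n (resampled (reweighted n z x) x')) - t\<bar>
    \<partial>selection (reweighted n z x)) \<partial>propagated n z)"
    by (intro nn_integral_step[OF n z] em')
  also have "\<dots> \<le> (\<integral>\<^sup>+x. ennreal (A * B * sqrt (max_weight z)) + ennreal \<bar>?e (reweighted n z x) - t\<bar> \<partial>propagated n z)"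
  proof (rule nn_integral_mono)
    fix x assume x: "x \<in> space (propagated n z)"
    let ?r = "reweighted n z x"
    have r: "?r \<in> space configs" using x by (rule measurable_space[OF reweighted_measurable[OF n z]])
    note rm = resampled_measurable[OF r]
    interpret S: prob_space "selection ?r" by (rule selection_in(1)[OF r])
    have "(\<integral>\<^sup>+x'. ennreal \<bar>?e (exchange n (resampled ?r x')) - t\<bar> \<partial>selection ?r)
      \<le> (\<integral>\<^sup>+x'. ennreal \<bar>?e (resampled ?r x') - ?e ?r\<bar> + ennreal \<bar>?e ?r - t\<bar> \<partial>selection ?r)"
    proof (rule nn_integral_mono)
      fix x' assume "x' \<in> space (selection ?r)"
      then have "resampled ?r x' \<in> space configs" by (rule measurable_space[OF rm])
      then have "?e (exchange n (resampled ?r x')) = ?e (resampled ?r x')" by (rule estimate_exchange[OF _ hm])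
      then show "ennreal \<bar>?e (exchange n (resampled ?r x')) - t\<bar>
          \<le> ennreal \<bar>?e (resampled ?r x') - ?e ?r\<bar> + ennreal \<bar>?e ?r - t\<bar>"
        by (simp flip: ennreal_plus add: ennreal_leI)
    qed
    also have "\<dots> = (\<integral>\<^sup>+x'. ennreal \<bar>?e (resampled ?r x') - ?e ?r\<bar> \<partial>selection ?r) + ennreal \<bar>?e ?r - t\<bar>"
      by (subst nn_integral_add)
        (simp_all only: S.nn_integral_prob_const measurable_compose[OF rm em'] borel_measurable_const)
    also have "\<dots> \<le> ennreal (B * sqrt (max_weight ?r)) + ennreal \<bar>?e ?r - t\<bar>"
      by (intro add_right_mono resample_error[OF r h])
    \<comment> \<open>Reweighting may have enlarged the largest share by \<open>A\<^sup>2\<close>,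
      hence its root by \<open>A\<close>. The chain then substitutes into the first summand only,
      and monotonicity of the sum is discharged at its end.\<close>
    also have "sqrt (max_weight ?r) \<le> A * sqrt (max_weight z)"
      using real_sqrt_le_mono[OF max_weight_reweighted[OF n z x]] A by (simp add: real_sqrt_mult)
    then have "ennreal (B * sqrt (max_weight ?r)) \<le> ennreal (A * B * sqrt (max_weight z))"
      using B0 mult_left_mono[of "sqrt (max_weight ?r)" "A * sqrt (max_weight z)" B]
      by (intro ennreal_leI) (simp add: mult_ac)
    finally show "(\<integral>\<^sup>+x'. ennreal \<bar>?e (exchange n (resampled ?r x')) - t\<bar> \<partial>selection ?r)
      \<le> ennreal (A * B * sqrt (max_weight z)) + ennreal \<bar>?e ?r - t\<bar>"
      by (simp add: add_right_mono)
  qed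
  also have "\<dots> = ennreal (A * B * sqrt (max_weight z)) + (\<integral>\<^sup>+x. ennreal \<bar>?e (reweighted n z x) - t\<bar> \<partial>propagated n z)"
    by (subst nn_integral_add)
      (simp_all only: P.nn_integral_prob_const measurable_compose[OF reweighted_measurable[OF n z] em'] borel_measurable_const)
  also have "\<dots> \<le> ennreal (A * B * sqrt (max_weight z)) + ennreal (2 * A\<^sup>2 * B * sqrt (max_weight z))"
    unfolding t_def by (intro add_left_mono sample_error[OF n z h])
  also have "\<dots> = ennreal (A * B * sqrt (max_weight z) + 2 * A\<^sup>2 * B * sqrt (max_weight z))"
    using A B0 max_weight_pos[OF z] by (intro ennreal_plus[symmetric]) auto
  also have "\<dots> \<le> ennreal (3 * A\<^sup>2 * B * sqrt (max_weight z))"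
  proof (rule ennreal_leI)
    \<comment> \<open>As \<open>A \<ge> 1\<close>, the resampling term fits under the power
      \<open>A\<^sup>2\<close>; this accounts for the constant 3.\<close>
    have "A * (B * sqrt (max_weight z)) \<le> A\<^sup>2 * (B * sqrt (max_weight z))"
      using A B0 max_weight_pos[OF z] self_le_power[of A 2] by (intro mult_right_mono) auto
    then show "A * B * sqrt (max_weight z) + 2 * A\<^sup>2 * B * sqrt (max_weight z) \<le> 3 * A\<^sup>2 * B * sqrt (max_weight z)"
      unfolding mult.assoc by linarith
  qed
  finally show ?thesis unfolding t_def .
qed

text \<open>Without an exchange only the likelihood changes the aggregate weights, so the bound
  holds for every outcome of the draws and not just on average.\<close>

lemma step_max_weight:
  assumes n: "n \<ge> 1" and z: "z \<in> space configs" and "\<not> n0 dvd n"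
  shows "(\<integral>\<^sup>+z'. ennreal (sqrt (max_weight z')) \<partial>step n z) \<le> ennreal (A * sqrt (max_weight z))"
proof -
  interpret P: prob_space "propagated n z" by (rule propagated_in(1)[OF n z])
  have "(\<integral>\<^sup>+z'. ennreal (sqrt (max_weight z')) \<partial>step n z) = (\<integral>\<^sup>+x. (\<integral>\<^sup>+x'. ennreal (sqrt (max_weight (exchange n (resampled (reweighted n z x) x'))))
    \<partial>selection (reweighted n z x)) \<partial>propagated n z)"
    by (intro nn_integral_step[OF n z]) measurable
  also have "\<dots> \<le> (\<integral>\<^sup>+x. ennreal (A * sqrt (max_weight z)) \<partial>propagated n z)"
  proof (rule nn_integral_mono)
    fix x assume x: "x \<in> space (propagated n z)"
    let ?r = "reweighted n z x"
    have r: "?r \<in> space configs" using x by (rule measurable_space[OF reweighted_measurable[OF n z]])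
    interpret S: prob_space "selection ?r" by (rule selection_in(1)[OF r])
    have "max_weight (exchange n (resampled ?r x')) = max_weight ?r" for x'
      using \<open>\<not> n0 dvd n\<close> max_weight_cong[OF aggregate_resampled] by (simp add: dpf_exchange_def)
    moreover have "sqrt (max_weight ?r) \<le> A * sqrt (max_weight z)"
      using real_sqrt_le_mono[OF max_weight_reweighted[OF n z x]] A by (simp add: real_sqrt_mult)
    ultimately show "(\<integral>\<^sup>+x'. ennreal (sqrt (max_weight (exchange n (resampled ?r x')))) \<partial>selection ?r)
      \<le> ennreal (A * sqrt (max_weight z))"
      by (simp only: S.nn_integral_prob_const ennreal_leI)
  qed
  also have "\<dots> = ennreal (A * sqrt (max_weight z))" by (rule P.nn_integral_prob_const)
  finally show ?thesis .
qed

section \<open>Propagation of errors through time\<close>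

text \<open>Runs the chain from an arbitrary law at time \<open>n\<close>. Started at the point mass
  of a configuration, it gives the conditional laws on which the forgetting argument relies.\<close>

primrec evolve :: "nat \<Rightarrow> nat \<Rightarrow> 'x config measure \<Rightarrow> 'x config measure"
  where
    "evolve n 0 L = L"
  | "evolve n (Suc T) L = evolve n T L \<bind> step (Suc (n + T))"

lemma step_subprob: "n \<ge> 1 \<Longrightarrow> step n \<in> configs \<rightarrow>\<^sub>M subprob_algebra configs"
  by (intro measurable_prob_algebraD step_measurable)

lemma configs_lawD:
  assumes "L \<in> space (prob_algebra configs)"
  shows "prob_space L" "sets L = sets configs" "space L = space configs"
  using assms sets_eq_imp_space_eq[of L configs] by (auto simp: space_prob_algebra)

lemma measurable_law:
  assumes "L \<in> space (prob_algebra configs)"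
  shows "f \<in> borel_measurable configs \<Longrightarrow> f \<in> borel_measurable L"
    and "k \<in> configs \<rightarrow>\<^sub>M N \<Longrightarrow> k \<in> L \<rightarrow>\<^sub>M N"
  using configs_lawD(2)[OF assms] by (simp_all cong: measurable_cong_sets)

lemma nn_integral_law_step:
  assumes L: "L \<in> space (prob_algebra configs)" and n: "n \<ge> 1" and f: "f \<in> borel_measurable configs"
  shows "(\<integral>\<^sup>+z. f z \<partial>(L \<bind> step n)) = (\<integral>\<^sup>+z. (\<integral>\<^sup>+z'. f z' \<partial>step n z) \<partial>L)"
  by (rule nn_integral_bind[OF f measurable_law(2)[OF L step_subprob[OF n]]])

lemma evolve_in:
  assumes L: "L \<in> space (prob_algebra configs)"
  shows "evolve n T L \<in> space (prob_algebra configs)"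
proof (induction T)
  case (Suc T)
  have "step (Suc (n + T)) \<in> configs \<rightarrow>\<^sub>M prob_algebra configs" by (rule step_measurable) simp
  from prob_space_bind'[OF Suc this] sets_bind'[OF Suc this] show ?case
    by (simp add: space_prob_algebra)
qed (simp add: L)

lemma evolve_law: "evolve n T (law n) = law (n + T)"
  by (induction T) simp_all

lemma evolve_kernel: "(\<lambda>z. evolve n T (return configs z)) \<in> configs \<rightarrow>\<^sub>M prob_algebra configs"
proof (induction T)
  case 0
  show ?case using measurable_return_prob_space[of configs] by simp
next
  case (Suc T)
  show ?case unfolding evolve.simps by (rule measurable_bind_prob_space[OF Suc step_measurable]) simp
qed

text \<open>The Markov property at time \<open>n\<close>: first draw a configuration from
  \<open>L\<close>, then run the chain from it.\<close>

lemma evolve_eq_bind: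
  assumes L: "L \<in> space (prob_algebra configs)"
  shows "evolve n T L = L \<bind> (\<lambda>z. evolve n T (return configs z))"
proof (induction T)
  case 0
  show ?case using bind_return''[OF configs_lawD(2)[OF L]] by simp
next
  case (Suc T)
  show ?case
    unfolding evolve.simps Suc
    by (rule bind_assoc[OF measurable_law(2)[OF L measurable_prob_algebraD[OF evolve_kernel]] step_subprob]) simp
qed

lemma nn_integral_evolve:
  assumes L: "L \<in> space (prob_algebra configs)" and f: "f \<in> borel_measurable configs"
  shows "(\<integral>\<^sup>+z. f z \<partial>evolve n T L) = (\<integral>\<^sup>+z. (\<integral>\<^sup>+z'. f z' \<partial>evolve n T (return configs z)) \<partial>L)"
  by (subst evolve_eq_bind[OF L])
    (rule nn_integral_bind[OF f measurable_law(2)[OF L measurable_prob_algebraD[OF evolve_kernel]]])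

section \<open>The flow of the optimal filter and mean errors along it\<close>

abbreviation "flow \<equiv> Psi_flow tau G"

lemma flow_refl: "flow n n \<alpha> = \<alpha>"
  by (cases n) simp_all

lemma flow_in: "\<alpha> \<in> prob_measures_on X \<Longrightarrow> flow (n + T) n \<alpha> \<in> prob_measures_on X"
  by (induction T) (simp_all add: flow_refl Psi_in)

lemma flow_filter: "flow (n + T) n (filter_measure tau0 tau G n) = filter_measure tau0 tau G (n + T)"
  by (induction T) (simp_all add: flow_refl)

lemma filter_in: "filter_measure tau0 tau G n \<in> prob_measures_on X"
  using flow_in[OF tau0, of 0 n] flow_filter[of 0 n] by simp

abbreviation "mean_sqrt_max_weight L \<equiv> (\<integral>\<^sup>+z. ennreal (sqrt (max_weight z)) \<partial>L)"

abbreviation "deviation h \<alpha> L \<equiv> (\<integral>\<^sup>+z. ennreal \<bar>(\<integral>u. h u \<partial>estimate z) - (\<integral>u. h u \<partial>\<alpha>)\<bar> \<partial>L)"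

lemma deviation_measurable:
  assumes "bounded_by B h"
  shows "(\<lambda>z. ennreal \<bar>(\<integral>u. h u \<partial>estimate z) - s\<bar>) \<in> borel_measurable configs"
  by (intro measurable_compose[OF _ measurable_ennreal] borel_measurable_abs borel_measurable_diff
      estimate_measurable[OF bounded_byD(1)[OF assms]] borel_measurable_const)

lemma sqrt_max_weight_measurable: "(\<lambda>z. ennreal (sqrt (max_weight z))) \<in> borel_measurable configs"
  by measurable

text \<open>Triangle inequality through \<open>Psi\<close> applied to the random estimate:
  \<open>step_error\<close> bounds the new Monte Carlo error, \<open>Psi_diff_le\<close> the
  inherited one. The premise covers all test functions, as the inherited error is tested with
  \<open>push n h\<close> and the \<open>push\<close> of 1.\<close>

lemma deviation_step:
  assumes L: "L \<in> space (prob_algebra configs)" and \<alpha>: "\<alpha> \<in> prob_measures_on X" and n: "n \<ge> 1"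
    and dev: "\<And>B h. bounded_by B h \<Longrightarrow> deviation h \<alpha> L \<le> ennreal B * Q"
    and h: "bounded_by B h"
  shows "deviation h (Psi tau G n \<alpha>) (L \<bind> step n)
    \<le> ennreal B * (ennreal (3 * A\<^sup>2) * (Q + mean_sqrt_max_weight L))"
proof -
  note B0 = bounded_by_nonneg[OF h]
  let ?e = "\<lambda>h z. \<integral>u. h u \<partial>estimate z"
  let ?t = "\<integral>u. h u \<partial>Psi tau G n \<alpha>"
  let ?d = "\<lambda>h z. ennreal \<bar>?e h z - (\<integral>u. h u \<partial>\<alpha>)\<bar>"
  note hp = bounded_by_push[OF n h] and p1 = bounded_by_push[OF n bounded_by_1]
  note m1 = measurable_law(1)[OF L deviation_measurable[OF hp]]
    and m2 = measurable_law(1)[OF L deviation_measurable[OF p1]]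
    and m3 = measurable_law(1)[OF L sqrt_max_weight_measurable]
  have "deviation h (Psi tau G n \<alpha>) (L \<bind> step n) = (\<integral>\<^sup>+z. (\<integral>\<^sup>+z'. ennreal \<bar>?e h z' - ?t\<bar> \<partial>step n z) \<partial>L)"
    by (rule nn_integral_law_step[OF L n deviation_measurable[OF h]])
  also have "\<dots> \<le> (\<integral>\<^sup>+z. ennreal (3 * A\<^sup>2 * B) * ennreal (sqrt (max_weight z))
      + ennreal A * (?d (push n h) z + ennreal B * ?d (push n (\<lambda>_. 1)) z) \<partial>L)"
  proof (rule nn_integral_mono)
    fix z assume "z \<in> space L"
    then have z: "z \<in> space configs" by (simp add: configs_lawD(3)[OF L])
    have S: "step n z \<in> space (prob_algebra configs)" by (rule measurable_space[OF step_measurable[OF n] z])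
    interpret S: prob_space "step n z" by (rule configs_lawD(1)[OF S])
    let ?s = "\<integral>u. h u \<partial>Psi tau G n (estimate z)"
    have "(\<integral>\<^sup>+z'. ennreal \<bar>?e h z' - ?t\<bar> \<partial>step n z) \<le> (\<integral>\<^sup>+z'. ennreal \<bar>?e h z' - ?s\<bar> + ennreal \<bar>?s - ?t\<bar> \<partial>step n z)"
      by (intro nn_integral_mono) (simp flip: ennreal_plus add: ennreal_leI)
    also have "\<dots> = (\<integral>\<^sup>+z'. ennreal \<bar>?e h z' - ?s\<bar> \<partial>step n z) + ennreal \<bar>?s - ?t\<bar>"
      by (subst nn_integral_add) (simp_all only: S.nn_integral_prob_const borel_measurable_const
          measurable_law(1)[OF S deviation_measurable[OF h]])
    also have "\<dots> \<le> ennreal (3 * A\<^sup>2 * B * sqrt (max_weight z))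
        + ennreal (A * (\<bar>?e (push n h) z - (\<integral>u. push n h u \<partial>\<alpha>)\<bar> + B * \<bar>?e (push n (\<lambda>_. 1)) z - (\<integral>u. push n (\<lambda>_. 1) u \<partial>\<alpha>)\<bar>))"
      by (intro add_mono step_error[OF n z h] ennreal_leI Psi_diff_le[OF n estimate_in[OF z] \<alpha> h])
    also have "\<dots> = ennreal (3 * A\<^sup>2 * B) * ennreal (sqrt (max_weight z))
      + ennreal A * (?d (push n h) z + ennreal B * ?d (push n (\<lambda>_. 1)) z)"
      using A B0 max_weight_pos[OF z] by (simp add: ennreal_mult ennreal_plus)
    finally show "(\<integral>\<^sup>+z'. ennreal \<bar>?e h z' - ?t\<bar> \<partial>step n z) \<le> ennreal (3 * A\<^sup>2 * B) * ennreal (sqrt (max_weight z))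
      + ennreal A * (?d (push n h) z + ennreal B * ?d (push n (\<lambda>_. 1)) z)" .
  qed
  also have "\<dots> = ennreal (3 * A\<^sup>2 * B) * mean_sqrt_max_weight L
      + ennreal A * (deviation (push n h) \<alpha> L + ennreal B * deviation (push n (\<lambda>_. 1)) \<alpha> L)"
    by (simp only: nn_integral_add nn_integral_cmult borel_measurable_add borel_measurable_times_ennreal
        borel_measurable_const m1 m2 m3)
  also have "\<dots> \<le> ennreal (3 * A\<^sup>2 * B) * mean_sqrt_max_weight L
      + ennreal A * (ennreal (A * B) * Q + ennreal B * (ennreal (A * 1) * Q))"
    by (intro add_mono mult_left_mono order_refl dev[OF hp] dev[OF p1]) auto
  also have "\<dots> = ennreal (3 * A\<^sup>2 * B) * mean_sqrt_max_weight L + ennreal (2 * A\<^sup>2 * B) * Q"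
  proof -
    have "ennreal A * (ennreal (A * B) * Q + ennreal B * (ennreal (A * 1) * Q))
        = (ennreal A * ennreal (A * B) + ennreal A * (ennreal B * ennreal (A * 1))) * Q"
      by (simp only: distrib_left distrib_right mult.assoc)
    also have "ennreal A * ennreal (A * B) + ennreal A * (ennreal B * ennreal (A * 1)) = ennreal (2 * A\<^sup>2 * B)"
      using A B0 by (simp flip: ennreal_mult ennreal_plus add: power2_eq_square)
    finally show ?thesis by simp
  qed
  \<comment> \<open>The inherited error comes with the factor \<open>2 * A\<^sup>2\<close>; raising
    it to \<open>3 * A\<^sup>2\<close> gives both terms the same constant, ready for
    iteration.\<close>
  also have "\<dots> \<le> ennreal (3 * A\<^sup>2 * B) * mean_sqrt_max_weight L + ennreal (3 * A\<^sup>2 * B) * Q"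
    using B0 by (intro add_left_mono mult_right_mono ennreal_leI) (auto intro!: mult_right_mono)
  also have "\<dots> = ennreal B * (ennreal (3 * A\<^sup>2) * (Q + mean_sqrt_max_weight L))"
    using A B0 by (simp add: ennreal_mult distrib_left mult_ac add_ac)
  finally show ?thesis .
qed

text \<open>Iterates \<open>deviation_step\<close> with the ratio \<open>3 * A\<^sup>2\<close>. It
  is applied from a point mass, where \<open>e\<close> is 0, and from the prior, where
  \<open>e\<close> is the initial Monte Carlo error. The constant grows exponentially in
  \<open>T\<close>, so it is useful over a bounded horizon only.\<close>

lemma deviation_evolve:
  assumes L: "L \<in> space (prob_algebra configs)" and \<alpha>: "\<alpha> \<in> prob_measures_on X"
    and dev: "\<And>B h. bounded_by B h \<Longrightarrow> deviation h \<alpha> L \<le> ennreal B * e"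
    and h: "bounded_by B h"
  shows "deviation h (flow (n + T) n \<alpha>) (evolve n T L)
    \<le> ennreal B * (ennreal (3 * A\<^sup>2) ^ T * (e + (\<Sum>j<T. mean_sqrt_max_weight (evolve n j L))))"
  using h
proof (induction T arbitrary: B h)
  case 0
  then show ?case using dev[of B h] by (simp add: flow_refl)
next
  case (Suc T)
  define C where "C = ennreal (3 * A\<^sup>2)"
  define s where "s = (\<Sum>j<T. mean_sqrt_max_weight (evolve n j L))"
  define w where "w = mean_sqrt_max_weight (evolve n T L)"
  have "1 \<le> 3 * A\<^sup>2" using one_le_power[OF A, of 2] by linarith
  then have C: "1 \<le> C" unfolding C_def using ennreal_leI by fastforce
  have "deviation h (flow (n + Suc T) n \<alpha>) (evolve n (Suc T) L) \<le>
     ennreal B * (C * (C ^ T * (e + s) + w))"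
    using deviation_step[OF evolve_in[OF L] flow_in[OF \<alpha>] _ Suc.IH Suc.prems, of "Suc (n + T)"]
    by (simp add: C_def s_def w_def)
  \<comment> \<open>Since \<open>C \<ge> 1\<close>, the newest term may be put under the same power
    of \<open>C\<close> as the older ones.\<close>
  also have "\<dots> \<le> ennreal B * (C * (C ^ T * (e + s) + C ^ T * w))"
    using one_le_power[OF C, of T] mult_right_mono[of 1 "C ^ T" w]
    by (intro mult_left_mono add_left_mono) auto
  also have "\<dots> = ennreal B * (C ^ Suc T * (e + (s + w)))"
    by (simp add: distrib_left mult.assoc add.assoc)
  finally show ?case unfolding C_def s_def w_def by simp
qed

section \<open>Uniform bounds\<close>

text \<open>None of the \<open>s\<close> times after \<open>r * n0\<close> is a multiple of
  \<open>n0\<close>, so each step costs at most the factor \<open>A\<close>.\<close>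

lemma max_weight_between_exchanges:
  assumes "s < n0"
  shows "mean_sqrt_max_weight (law (r * n0 + s)) \<le> ennreal (A ^ s) * mean_sqrt_max_weight (law (r * n0))"
  using assms
proof (induction s)
  case (Suc s)
  let ?n = "r * n0 + s"
  have "\<not> n0 dvd Suc ?n"
  proof
    assume "n0 dvd Suc ?n"
    then have "n0 dvd Suc s" by (metis add_Suc_right dvd_add_right_iff dvd_triv_right)
    with Suc.prems show False by (auto dest: dvd_imp_le)
  qed
  have "mean_sqrt_max_weight (law (Suc ?n)) = (\<integral>\<^sup>+z. mean_sqrt_max_weight (step (Suc ?n) z) \<partial>law ?n)"
    unfolding dpf_law.simps by (intro nn_integral_law_step law_in sqrt_max_weight_measurable) simp
  also have "\<dots> \<le> (\<integral>\<^sup>+z. ennreal A * ennreal (sqrt (max_weight z)) \<partial>law ?n)"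
  proof (rule nn_integral_mono)
    fix z assume "z \<in> space (law ?n)"
    then have z: "z \<in> space configs" by (simp add: configs_lawD(3)[OF law_in])
    show "mean_sqrt_max_weight (step (Suc ?n) z) \<le> ennreal A * ennreal (sqrt (max_weight z))"
      using step_max_weight[OF _ z \<open>\<not> n0 dvd Suc ?n\<close>] A max_weight_pos[OF z] by (simp add: ennreal_mult)
  qed
  also have "\<dots> = ennreal A * mean_sqrt_max_weight (law ?n)"
    by (intro nn_integral_cmult measurable_law(1)[OF law_in] sqrt_max_weight_measurable)
  also have "\<dots> \<le> ennreal A * (ennreal (A ^ s) * mean_sqrt_max_weight (law (r * n0)))"
    using Suc by (intro mult_left_mono) auto
  also have "\<dots> = ennreal (A ^ Suc s) * mean_sqrt_max_weight (law (r * n0))"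
    using A by (simp add: ennreal_mult mult.assoc)
  finally show ?case by simp
qed simp

text \<open>Every time lies fewer than \<open>n0\<close> steps after a multiple of
  \<open>n0\<close>, so control at the exchange times, time 0 included, extends to all
  times.\<close>

lemma max_weight_uniform:
  assumes n0: "n0 \<ge> 1" and \<sigma>: "\<And>r. mean_sqrt_max_weight (law (r * n0)) \<le> ennreal \<sigma>"
  shows "mean_sqrt_max_weight (law n) \<le> ennreal (A ^ n0 * \<sigma>)"
proof -
  have "mean_sqrt_max_weight (law (n div n0 * n0 + n mod n0))
      \<le> ennreal (A ^ (n mod n0)) * mean_sqrt_max_weight (law (n div n0 * n0))"
    using n0 by (intro max_weight_between_exchanges) simp
  also have "\<dots> \<le> ennreal (A ^ n0) * ennreal \<sigma>"
  proof (intro mult_mono \<sigma> ennreal_leI power_increasing A)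
    have "n mod n0 < n0" using n0 by simp
    then show "n mod n0 \<le> n0" by simp
  qed auto
  finally show ?thesis using A by (simp add: ennreal_mult')
qed

lemma init_deviation:
  assumes h: "bounded_by B h"
  shows "deviation h tau0 (law 0) \<le> ennreal B * ennreal (1 / sqrt M)"
proof -
  note hm = bounded_byD(1)[OF h]
  let ?P = "PiM (particles M K) (\<lambda>_. tau0)"
  let ?w = "\<lambda>i\<in>particles M K. 1 / (real M * real K)"
  have MK: "real M * real K > 0" using M K by simp
  have setsP: "sets ?P = sets (PiM (particles M K) (\<lambda>_. borel_on X))"
    using prob_measuresD(2)[OF tau0] by (intro sets_PiM_cong) auto
  have pm: "(\<lambda>x. (x, ?w)) \<in> ?P \<rightarrow>\<^sub>M configs"
    unfolding config_space_def
    by (intro measurable_Pair measurable_ident_sets setsP measurable_restrict measurable_const)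
      (use M K in \<open>simp add: space_restrict_space\<close>)
  have card: "(\<Sum>i\<in>particles M K. 1 / (real M * real K)) = 1"
    using M K by simp
  have e: "(\<integral>u. h u \<partial>estimate (x, ?w)) = (\<Sum>i\<in>particles M K. 1 / (real M * real K) * h (x i))"
    if x: "x \<in> space ?P" for x
  proof -
    have "total (x, ?w) = (\<Sum>i\<in>particles M K. 1 / (real M * real K))"
      unfolding total_def by (intro sum.cong) auto
    then have "total (x, ?w) = 1" unfolding card .
    then show ?thesis
      unfolding integral_estimate[OF measurable_space[OF pm x] hm] by (intro sum.cong) auto
  qed
  have "deviation h tau0 (law 0) = (\<integral>\<^sup>+x. ennreal \<bar>(\<integral>u. h u \<partial>estimate (x, ?w)) - (\<integral>u. h u \<partial>tau0)\<bar> \<partial>?P)"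
    unfolding dpf_law.simps dpf_init_def
    by (rule nn_integral_distr[OF pm]) (simp add: deviation_measurable[OF h])
  also have "\<dots> = (\<integral>\<^sup>+x. ennreal \<bar>\<Sum>i\<in>particles M K. 1 / (real M * real K) * (h (x i) - (\<integral>u. h u \<partial>tau0))\<bar> \<partial>?P)"
  proof (rule nn_integral_cong)
    fix x assume x: "x \<in> space ?P"
    have "(\<Sum>i\<in>particles M K. 1 / (real M * real K) * (h (x i) - (\<integral>u. h u \<partial>tau0)))
      = (\<integral>u. h u \<partial>estimate (x, ?w)) - (\<Sum>i\<in>particles M K. 1 / (real M * real K)) * (\<integral>u. h u \<partial>tau0)"
      unfolding e[OF x] right_diff_distrib sum_subtractf sum_distrib_right ..
    then show "ennreal \<bar>(\<integral>u. h u \<partial>estimate (x, ?w)) - (\<integral>u. h u \<partial>tau0)\<bar>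
      = ennreal \<bar>\<Sum>i\<in>particles M K. 1 / (real M * real K) * (h (x i) - (\<integral>u. h u \<partial>tau0))\<bar>"
      unfolding card by simp
  qed
  also have "\<dots> \<le> ennreal (sqrt (\<Sum>i\<in>particles M K. (1 / (real M * real K))\<^sup>2 * B\<^sup>2))"
    using bounded_byD(2)[OF h] prob_measuresD(3)[OF tau0]
    by (intro PiM_deviation prob_measuresD(1)[OF tau0] measurable_on[OF tau0 hm]) auto
  also have "\<dots> \<le> ennreal (\<bar>B\<bar> * sqrt (1 / M))"
  proof (intro ennreal_leI sqrt_sum_squares_le card conjI)
    have "real M * 1 \<le> real M * real K" using M K by (intro mult_left_mono) auto
    then show "1 / (real M * real K) \<le> 1 / M" using M by (intro divide_left_mono) auto
  qed (use MK in simp)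
  finally show ?thesis using bounded_by_nonneg[OF h] by (simp flip: ennreal_mult add: real_sqrt_divide)
qed

text \<open>The bound is free of \<open>n\<close>: at most the last \<open>T\<close> steps are
  charged for Monte Carlo errors, and forgetting pays for everything earlier. Before time
  \<open>T\<close> the comparison starts directly from the prior.\<close>

lemma deviation_uniform:
  assumes h: "bounded_by B h" and "0 \<le> \<sigma>" and "0 \<le> \<delta>"
    and \<sigma>: "\<And>n. mean_sqrt_max_weight (law n) \<le> ennreal \<sigma>"
    and \<delta>: "\<And>n \<alpha> \<eta>. \<alpha> \<in> prob_measures_on X \<Longrightarrow> \<eta> \<in> prob_measures_on X \<Longrightarrow>
      \<bar>(\<integral>x. h x \<partial>flow (n + T) n \<alpha>) - (\<integral>x. h x \<partial>flow (n + T) n \<eta>)\<bar> \<le> \<delta>"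
  shows "deviation h (filter_measure tau0 tau G n) (law n)
    \<le> ennreal (\<delta> + B * ((3 * A\<^sup>2) ^ T * (1 / sqrt M + T * \<sigma>)))"
proof -
  note B0 = bounded_by_nonneg[OF h]
  have C1: "1 \<le> 3 * A\<^sup>2" using one_le_power[OF A, of 2] by linarith
  have bound: "ennreal B * (ennreal (3 * A\<^sup>2) ^ S * (ennreal e + (\<Sum>j<S. ennreal \<sigma>)))
      = ennreal (B * ((3 * A\<^sup>2) ^ S * (e + S * \<sigma>)))" if "0 \<le> e" for e S
  proof -
    define C where "C = 3 * A\<^sup>2"
    have "0 \<le> C" using C1 by (simp add: C_def)
    then show ?thesis
      unfolding C_def[symmetric] using B0 that \<open>0 \<le> \<sigma>\<close>
      by (simp add: ennreal_mult ennreal_plus ennreal_power ennreal_of_nat_eq_real_of_nat)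
  qed
  show ?thesis
  proof (cases "T \<le> n")
    case True
    \<comment> \<open>Condition on the configuration at time \<open>k\<close> and compare two flows
      from there: one started at its estimate, the other at the true filter.\<close>
    define k where "k = n - T"
    with True have n: "n = k + T" by simp
    let ?\<pi> = "filter_measure tau0 tau G"
    let ?L = "\<lambda>j z. evolve k j (return configs z)"
    define D where "D = ennreal B * ennreal (3 * A\<^sup>2) ^ T"
    have "deviation h (?\<pi> n) (law n) = (\<integral>\<^sup>+z. deviation h (?\<pi> n) (?L T z) \<partial>law k)"
      unfolding n evolve_law[symmetric] by (rule nn_integral_evolve[OF law_in deviation_measurable[OF h]])
    also have "\<dots> \<le> (\<integral>\<^sup>+z. D * (\<Sum>j<T. mean_sqrt_max_weight (?L j z)) + ennreal \<delta> \<partial>law k)"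
    proof (rule nn_integral_mono)
      fix z assume "z \<in> space (law k)"
      then have z: "z \<in> space configs" by (simp add: configs_lawD(3)[OF law_in])
      have R: "return configs z \<in> space (prob_algebra configs)"
        using z by (simp add: space_prob_algebra prob_space_return)
      interpret L: prob_space "?L T z" by (rule configs_lawD(1)[OF evolve_in[OF R]])
      let ?\<phi> = "flow (k + T) k (estimate z)"
      have "deviation h (?\<pi> n) (?L T z) \<le> (\<integral>\<^sup>+z'. ennreal \<bar>(\<integral>u. h u \<partial>estimate z') - (\<integral>u. h u \<partial>?\<phi>)\<bar>
          + ennreal \<delta> \<partial>?L T z)"
      proof (rule nn_integral_mono)
        fix z'
        have "\<bar>(\<integral>u. h u \<partial>?\<phi>) - (\<integral>u. h u \<partial>?\<pi> n)\<bar> \<le> \<delta>"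
          using \<delta>[OF estimate_in[OF z] filter_in, of k k] by (simp add: n flow_filter)
        then show "ennreal \<bar>(\<integral>u. h u \<partial>estimate z') - (\<integral>u. h u \<partial>?\<pi> n)\<bar>
          \<le> ennreal \<bar>(\<integral>u. h u \<partial>estimate z') - (\<integral>u. h u \<partial>?\<phi>)\<bar> + ennreal \<delta>"
          using \<open>0 \<le> \<delta>\<close> by (simp flip: ennreal_plus add: ennreal_leI)
      qed
      also have "\<dots> = deviation h ?\<phi> (?L T z) + ennreal \<delta>"
        by (subst nn_integral_add) (simp_all only: L.nn_integral_prob_const borel_measurable_const
          measurable_law(1)[OF evolve_in[OF R] deviation_measurable[OF h]])
      \<comment> \<open>At the point mass of \<open>z\<close> the estimate is itself the starting
        point of the flow, so the initial error is 0.\<close>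
      also have "deviation h ?\<phi> (?L T z)
          \<le> ennreal B * (ennreal (3 * A\<^sup>2) ^ T * (0 + (\<Sum>j<T. mean_sqrt_max_weight (?L j z))))"
        by (rule deviation_evolve[OF R estimate_in[OF z] _ h])
          (simp add: nn_integral_return[OF z deviation_measurable])
      then have "deviation h ?\<phi> (?L T z) + ennreal \<delta> \<le> D * (\<Sum>j<T. mean_sqrt_max_weight (?L j z)) + ennreal \<delta>"
        by (simp add: D_def mult.assoc add_right_mono)
      finally show "deviation h (?\<pi> n) (?L T z) \<le> D * (\<Sum>j<T. mean_sqrt_max_weight (?L j z)) + ennreal \<delta>" .
    qed
    also have "\<dots> = D * (\<Sum>j<T. \<integral>\<^sup>+z. mean_sqrt_max_weight (?L j z) \<partial>law k) + ennreal \<delta>"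
    proof -
      have "(\<lambda>z. mean_sqrt_max_weight (?L j z)) \<in> borel_measurable (law k)" for j
        by (intro measurable_law(1)[OF law_in] measurable_compose[OF measurable_prob_algebraD[OF evolve_kernel]
            nn_integral_measurable_subprob_algebra[OF sqrt_max_weight_measurable]])
      then show ?thesis
        by (simp only: nn_integral_add nn_integral_cmult nn_integral_sum borel_measurable_sum
            borel_measurable_times_ennreal borel_measurable_const
            prob_space.nn_integral_prob_const[OF configs_lawD(1)[OF law_in]])
    qed
    \<comment> \<open>By the Markov property, averaging over \<open>z\<close> restores the
      unconditional laws, for which \<open>\<sigma>\<close> is available.\<close>
    also have "\<dots> = D * (\<Sum>j<T. mean_sqrt_max_weight (law (k + j))) + ennreal \<delta>"
      by (simp only: nn_integral_evolve[OF law_in sqrt_max_weight_measurable, symmetric] evolve_law)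
    \<comment> \<open>The term \<open>1 / sqrt M\<close> is added to reach the same bound as in the
      case starting from the prior.\<close>
    also have "\<dots> \<le> D * (ennreal (1 / sqrt M) + (\<Sum>j<T. ennreal \<sigma>)) + ennreal \<delta>"
      by (intro add_right_mono mult_left_mono add_increasing sum_mono \<sigma>) auto
    also have "\<dots> = ennreal (\<delta> + B * ((3 * A\<^sup>2) ^ T * (1 / sqrt M + T * \<sigma>)))"
      using bound[of "1 / sqrt M" T] C1 B0 \<open>0 \<le> \<delta>\<close> \<open>0 \<le> \<sigma>\<close>
      by (simp add: D_def mult.assoc add.commute ennreal_plus)
    finally show ?thesis .
  next
    case False
    have "deviation h (filter_measure tau0 tau G (0 + n)) (law (0 + n)) =
      deviation h (flow (0 + n) 0 tau0) (evolve 0 n (law 0))"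
      unfolding evolve_law flow_filter[of 0 n, symmetric] by simp
    also have "\<dots> \<le> ennreal B * (ennreal (3 * A\<^sup>2) ^ n * (ennreal (1 / sqrt M) + (\<Sum>j<n. mean_sqrt_max_weight (evolve 0 j (law 0)))))"
      by (rule deviation_evolve[OF law_in tau0 init_deviation h])
    also have "\<dots> \<le> ennreal B * (ennreal (3 * A\<^sup>2) ^ n * (ennreal (1 / sqrt M) + (\<Sum>j<n. ennreal \<sigma>)))"
      unfolding evolve_law by (intro mult_left_mono add_left_mono sum_mono \<sigma>) auto
    also have "\<dots> = ennreal (B * ((3 * A\<^sup>2) ^ n * (1 / sqrt M + n * \<sigma>)))" by (rule bound) simp
    also have "\<dots> \<le> ennreal (\<delta> + B * ((3 * A\<^sup>2) ^ T * (1 / sqrt M + T * \<sigma>)))"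
    proof (rule ennreal_leI)
      have "(3 * A\<^sup>2) ^ n * (1 / sqrt M + n * \<sigma>) \<le> (3 * A\<^sup>2) ^ T * (1 / sqrt M + T * \<sigma>)"
        using False C1 \<open>0 \<le> \<sigma>\<close>
        by (intro mult_mono power_increasing add_left_mono mult_right_mono) auto
      from mult_left_mono[OF this B0] \<open>0 \<le> \<delta>\<close>
      show "B * ((3 * A\<^sup>2) ^ n * (1 / sqrt M + n * \<sigma>)) \<le> \<delta> + B * ((3 * A\<^sup>2) ^ T * (1 / sqrt M + T * \<sigma>))"
        by linarith
    qed
    finally show ?thesis by simp
  qed
qed

lemma mean_sqrt_max_weight_le:
  assumes q: "1 \<le> q" and t: "0 < t"
    and I: "(\<integral>z. max_weight z powr q \<partial>law n) \<le> I"
  shows "mean_sqrt_max_weight (law n) \<le> ennreal (t + I / t powr (2 * q - 1))"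
proof -
  interpret prob_space "law n" by (rule configs_lawD(1)[OF law_in])
  have m: "max_weight \<in> borel_measurable (law n)"
    by (rule measurable_law(1)[OF law_in max_weight_measurable])
  have pos: "0 < max_weight z" "max_weight z \<le> 1" if "z \<in> space (law n)" for z
    using that max_weight_pos max_weight_le_1 by (simp_all add: configs_lawD(3)[OF law_in])
  \<comment> \<open>Integrability, here from shares being at most 1, gives the Bochner integral in
    \<open>I\<close> its meaning: for a non-integrable function it would be 0 by default.\<close>
  have i: "integrable (law n) (\<lambda>z. max_weight z powr q)"
    using m pos q powr_mono2[of q _ 1]
    by (intro integrable_const_bound[where B=1] AE_I2) (auto simp: less_imp_le)
  have "mean_sqrt_max_weight (law n) \<le> (\<integral>\<^sup>+z. ennreal (t + max_weight z powr q / t powr (2 * q - 1)) \<partial>law n)"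
    by (intro nn_integral_mono ennreal_leI sqrt_le_powr pos t q)
  also have "\<dots> = ennreal (\<integral>z. t + max_weight z powr q / t powr (2 * q - 1) \<partial>law n)"
    using i t by (intro nn_integral_eq_integral) auto
  also have "(\<integral>z. t + max_weight z powr q / t powr (2 * q - 1) \<partial>law n)
      = t + (\<integral>z. max_weight z powr q \<partial>law n) / t powr (2 * q - 1)"
    using i by (simp add: prob_space)
  also have "\<dots> \<le> t + I / t powr (2 * q - 1)"
    using I t by (intro add_left_mono divide_right_mono) auto
  finally show ?thesis by (simp add: ennreal_leI)
qed

lemma Lp_error_le:
  assumes h: "bounded_by B h" and p: "1 \<le> p" and d: "0 \<le> d"
    and dev: "deviation h (filter_measure tau0 tau G n) (law n) \<le> ennreal d"
  shows "Lp_norm (law n) p (\<lambda>z. (\<integral>x. h x \<partial>estimate z) - (\<integral>x. h x \<partial>filter_measure tau0 tau G n))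
    \<le> ((2 * B) powr (p - 1) * d) powr (1 / p)"
proof (rule Lp_norm_le_L1[OF configs_lawD(1)[OF law_in] _ _ p d dev])
  show "(\<lambda>z. (\<integral>x. h x \<partial>estimate z) - (\<integral>x. h x \<partial>filter_measure tau0 tau G n)) \<in> borel_measurable (law n)"
    by (intro measurable_law(1)[OF law_in] borel_measurable_diff borel_measurable_const
        estimate_measurable[OF bounded_byD(1)[OF h]])
  fix z assume "z \<in> space (law n)"
  then have "z \<in> space configs" by (simp add: configs_lawD(3)[OF law_in])
  from abs_integral_le[OF estimate_in[OF this] h] abs_integral_le[OF filter_in h, of n]
  show "\<bar>(\<integral>x. h x \<partial>estimate z) - (\<integral>x. h x \<partial>filter_measure tau0 tau G n)\<bar> \<le> 2 * B" by linarith
qed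

end

section \<open>Choice of the horizon and passage to the limit\<close>

theorem theorem1:
  fixes X :: "'x::euclidean_space set"
    and tau0 :: "'x measure"
    and tau :: "nat \<Rightarrow> 'x \<Rightarrow> 'x measure"
    and g :: "nat \<Rightarrow> 'y::euclidean_space \<Rightarrow> 'x \<Rightarrow> real"
    and y :: "nat \<Rightarrow> 'y"
    and G :: "nat \<Rightarrow> 'x \<Rightarrow> real"
    and a :: "nat \<Rightarrow> real"
    and K n0 :: nat
    and \<beta> :: "nat \<Rightarrow> nat \<times> nat \<Rightarrow> nat \<times> nat"
    and c \<epsilon> q :: real
  assumes model: "state_space_model X tau0 tau g"
    and G_def: "G = (\<lambda>n. g n (y n))"
    and "K \<ge> 1" and "n0 \<ge> 1"
    and exchange: "\<And>M. M \<ge> 1 \<Longrightarrow> bij_betw (\<beta> M) (particles M K) (particles M K)"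
    and a_pos: "\<And>n. a n > 0" and a_bounded: "bounded (range a)"
    and likelihood_bounds: "\<And>n x. n \<ge> 1 \<Longrightarrow> x \<in> X \<Longrightarrow> 1 / a n \<le> G n x \<and> G n x \<le> a n"
    and stability_finite:
      "\<And>h T. h \<in> bounded_functions X \<Longrightarrow> forgetting_error X tau G h T < \<infinity>"
    and stability_limit:
      "\<And>h. h \<in> bounded_functions X \<Longrightarrow> (\<lambda>T. forgetting_error X tau G h T) \<longlonglongrightarrow> 0"
    and "0 \<le> c" and "0 \<le> \<epsilon>" and "\<epsilon> < 1" and "q \<ge> 4"
    and exchange_weights:
      "\<And>M r. M \<ge> 1 \<Longrightarrow>
        (\<integral>z. (SUP m\<in>{1..M}. normalized_aggregate_weight M K z m) powr q
            \<partial>dpf_law X tau0 tau G M K n0 (\<beta> M) (r * n0))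
          \<le> c powr q / real M powr (q - \<epsilon>)"
  shows "\<forall>h \<in> bounded_functions X. \<forall>p. 1 \<le> p \<and> p \<le> q \<longrightarrow>
    (\<lambda>M. SUP n. ereal (Lp_norm (dpf_law X tau0 tau G M K n0 (\<beta> M) n) p
        (\<lambda>z. (\<integral>x. h x \<partial>dpf_measure X M K z) - (\<integral>x. h x \<partial>filter_measure tau0 tau G n))))
      \<longlonglongrightarrow> 0"
proof (intro ballI allI impI)
  fix h :: "'x \<Rightarrow> real" and p :: real
  assume h: "h \<in> bounded_functions X" and p: "1 \<le> p \<and> p \<le> q"
  interpret model: state_space_model X tau0 tau g by (rule model)
  obtain A where A: "1 \<le> A" and aA: "\<And>n. a n \<le> A"
  proof -
    obtain b where "\<And>n. \<bar>a n\<bar> \<le> b" using a_bounded by (auto simp: bounded_iff)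
    then have "a n \<le> max 1 b" for n by (smt (verit) max.cobounded2)
    then show thesis using that[of "max 1 b"] by simp
  qed
  \<comment> \<open>A bound of at least 1 makes \<open>2 * B\<close> positive, so the definition of
    \<open>d\<close> below may divide by its power.\<close>
  obtain B where B: "1 \<le> B" and hB: "\<And>x. x \<in> X \<Longrightarrow> \<bar>h x\<bar> \<le> B"
  proof -
    obtain b where "\<And>x. x \<in> X \<Longrightarrow> \<bar>h x\<bar> \<le> b" using h by (auto simp: bounded_functions_def bounded_iff)
    then have "\<bar>h x\<bar> \<le> max 1 b" if "x \<in> X" for x using that by (smt (verit) max.cobounded2)
    then show thesis using that[of "max 1 b"] by simp
  qed
  have G_meas: "G n \<in> borel_measurable (borel_on X)" if "n \<ge> 1" for n
  proof -
    have "(\<lambda>x. (y n, x)) \<in> borel_on X \<rightarrow>\<^sub>M borel \<Otimes>\<^sub>M borel_on X" by simp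
    from measurable_compose[OF this model.density_measurable[OF that]] show ?thesis by (simp add: G_def)
  qed
  have G_bounds: "1 / A \<le> G n x \<and> G n x \<le> A" if "n \<ge> 1" "x \<in> X" for n x
  proof -
    have "1 / A \<le> 1 / a n" using A aA[of n] a_pos[of n] by (intro divide_left_mono) auto
    then show ?thesis using likelihood_bounds[OF that] aA[of n] by linarith
  qed
  have filter: "particle_filter X tau0 tau G M K (\<beta> M) A" if "M \<ge> 1" for M
    using that \<open>K \<ge> 1\<close> model.prior model.kernel G_meas G_bounds A exchange
    by (intro particle_filter.intro) auto
  let ?Z = "\<lambda>M n z. (\<integral>x. h x \<partial>dpf_measure X M K z) - (\<integral>x. h x \<partial>filter_measure tau0 tau G n)"
  let ?E = "\<lambda>M n. Lp_norm (dpf_law X tau0 tau G M K n0 (\<beta> M) n) p (?Z M n)"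
  have uniform: "eventually (\<lambda>M. \<forall>n. ?E M n \<le> e) sequentially" if e: "e > 0" for e :: real
  proof -
    \<comment> \<open>This is the mean error which \<open>Lp_error_le\<close> converts into exactly
      \<open>e\<close>. It is split into three thirds: forgetting, the initial error and the
      weights.\<close>
    define d where "d = e powr p / (2 * B) powr (p - 1)"
    have d: "d > 0" using e B by (simp add: d_def)
    have de: "((2 * B) powr (p - 1) * d) powr (1 / p) = e"
      using e B p by (simp add: d_def powr_powr)
    have "eventually (\<lambda>T. forgetting_error X tau G h T < ereal (d / 3)) sequentially"
      using d by (intro order_tendstoD(2)[OF stability_limit[OF h]]) simp
    \<comment> \<open>The horizon depends on \<open>h\<close> and \<open>d\<close> but not on the
      number of processing elements, so the exponential constants below stay fixed as
      \<open>M\<close> grows.\<close>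
    then obtain T where T: "forgetting_error X tau G h T < ereal (d / 3)"
      by (auto simp: eventually_sequentially)
    have forget: "\<bar>(\<integral>x. h x \<partial>Psi_flow tau G (n + T) n \<alpha>) - (\<integral>x. h x \<partial>Psi_flow tau G (n + T) n \<eta>)\<bar> \<le> d / 3"
      if "\<alpha> \<in> prob_measures_on X" "\<eta> \<in> prob_measures_on X" for n \<alpha> \<eta>
    proof -
      have "ereal \<bar>(\<integral>x. h x \<partial>Psi_flow tau G (n + T) n \<alpha>) - (\<integral>x. h x \<partial>Psi_flow tau G (n + T) n \<eta>)\<bar>
          \<le> forgetting_error X tau G h T"
        unfolding forgetting_error_def
        by (rule SUP_upper2[OF that(1)], rule SUP_upper2[OF that(2)], rule SUP_upper2[OF UNIV_I]) (rule order_refl)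
      with T have "ereal \<bar>(\<integral>x. h x \<partial>Psi_flow tau G (n + T) n \<alpha>) - (\<integral>x. h x \<partial>Psi_flow tau G (n + T) n \<eta>)\<bar>
          < ereal (d / 3)" by (rule order_le_less_trans[rotated])
      then show ?thesis by simp
    qed
    \<comment> \<open>Besides forgetting, \<open>deviation_uniform\<close> leaves
      \<open>Q / sqrt M + R * t\<close>. In \<open>R\<close> the factor \<open>A ^ n0\<close> is the
      growth between exchanges, and 2 comes from the bound \<open>2 * t\<close> at exchange
      times.\<close>
    define Q where "Q = B * (3 * A\<^sup>2) ^ T"
    have Q: "Q > 0" using A B by (simp add: Q_def)
    define R where "R = Q * T * A ^ n0 * 2"
    have R: "R \<ge> 0" using A Q by (simp add: R_def)
    \<comment> \<open>Dividing by \<open>R + 1\<close> covers the case \<open>R = 0\<close>, which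
      occurs for \<open>T = 0\<close>.\<close>
    define t where "t = d / (3 * (R + 1))"
    have t: "t > 0" using d R by (simp add: t_def)
    have Rt: "R * t \<le> d / 3" using d R by (simp add: t_def field_simps)
    have "((\<lambda>M. Q * (1 / sqrt (real M))) \<longlongrightarrow> Q * 0) sequentially"
      by (intro tendsto_mult tendsto_const tendsto_divide_0[OF tendsto_const] filterlim_at_top_imp_at_infinity
          filterlim_compose[OF sqrt_at_top filterlim_real_sequentially])
    then have ev1: "eventually (\<lambda>M. Q * (1 / sqrt (real M)) < d / 3) sequentially"
      using d by (intro order_tendstoD(2)) auto
    \<comment> \<open>The second term of \<open>mean_sqrt_max_weight_le\<close> under hypothesis
      (3): for fixed \<open>t\<close> it vanishes because \<open>q - \<epsilon>\<close> is
      positive.\<close>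
    have "((\<lambda>M. c powr q * real M powr (- (q - \<epsilon>)) / t powr (2 * q - 1)) \<longlongrightarrow> c powr q * 0 / t powr (2 * q - 1)) sequentially"
      using \<open>\<epsilon> < 1\<close> \<open>q \<ge> 4\<close> t
      by (intro tendsto_divide tendsto_mult tendsto_const tendsto_neg_powr filterlim_real_sequentially) auto
    then have ev2: "eventually (\<lambda>M. c powr q * real M powr (- (q - \<epsilon>)) / t powr (2 * q - 1) < t) sequentially"
      using t by (intro order_tendstoD(2)) auto
    from ev1 ev2 eventually_ge_at_top[of 1] show ?thesis
    proof eventually_elim
      case (elim M)
      interpret particle_filter X tau0 tau G M K n0 "\<beta> M" A by (rule filter[OF elim(3)])
      have hb: "bounded_by B h" using h hB by (simp add: bounded_by_def bounded_functions_def)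
      have "mean_sqrt_max_weight (law (r * n0)) \<le> ennreal (2 * t)" for r
      proof -
        have "mean_sqrt_max_weight (law (r * n0)) \<le> ennreal (t + (c powr q / real M powr (q - \<epsilon>)) / t powr (2 * q - 1))"
          using exchange_weights[OF elim(3), of r] \<open>q \<ge> 4\<close>
          by (intro mean_sqrt_max_weight_le t) (simp_all add: max_weight_def)
        also have "\<dots> \<le> ennreal (2 * t)"
        proof (rule ennreal_leI)
          have "c powr q / real M powr (q - \<epsilon>) = c powr q * real M powr (- (q - \<epsilon>))"
            by (simp only: powr_minus divide_inverse)
          with elim(2) show "t + (c powr q / real M powr (q - \<epsilon>)) / t powr (2 * q - 1) \<le> 2 * t" by simp
        qed
        finally show ?thesis .
      qed
      from max_weight_uniform[OF \<open>n0 \<ge> 1\<close> this]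
      have \<sigma>: "mean_sqrt_max_weight (law n) \<le> ennreal (A ^ n0 * (2 * t))" for n .
      show ?case
      proof
        fix n
        have "deviation h (filter_measure tau0 tau G n) (law n)
            \<le> ennreal (d / 3 + B * ((3 * A\<^sup>2) ^ T * (1 / sqrt M + T * (A ^ n0 * (2 * t)))))"
          using A t d by (intro deviation_uniform[OF hb _ _ \<sigma> forget]) auto
        also have "\<dots> \<le> ennreal d"
        proof (rule ennreal_leI)
          have "B * ((3 * A\<^sup>2) ^ T * (1 / sqrt M + T * (A ^ n0 * (2 * t)))) = Q * (1 / sqrt M) + R * t"
            by (simp add: Q_def R_def distrib_left mult_ac)
          with elim(1) Rt show "d / 3 + B * ((3 * A\<^sup>2) ^ T * (1 / sqrt M + T * (A ^ n0 * (2 * t)))) \<le> d" by linarith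
        qed
        finally show "?E M n \<le> e"
          using Lp_error_le[OF hb _ less_imp_le[OF d], of p n] p de by simp
      qed
    qed
  qed
  show "(\<lambda>M. SUP n. ereal (?E M n)) \<longlonglongrightarrow> 0"
  proof (rule order_tendstoI)
    fix u :: ereal assume "u < 0"
    have "0 \<le> (SUP n. ereal (?E M n))" for M
      by (rule SUP_upper2[OF UNIV_I[of 0]]) (simp add: Lp_norm_def)
    with \<open>u < 0\<close> show "eventually (\<lambda>M. u < (SUP n. ereal (?E M n))) sequentially"
      by (intro always_eventually allI) (rule less_le_trans)
  next
    fix u :: ereal assume "0 < u"
    \<comment> \<open>A bound valid for all \<open>n\<close> passes to the supremum only as a weak
      inequality, so \<open>e\<close> is taken strictly below \<open>u\<close>.\<close>
    then obtain e where e: "0 < ereal e" "ereal e < u" using ereal_dense2 by blast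
    then have "eventually (\<lambda>M. \<forall>n. ?E M n \<le> e) sequentially" by (intro uniform) simp
    then show "eventually (\<lambda>M. (SUP n. ereal (?E M n)) < u) sequentially"
    proof eventually_elim
      case (elim M)
      then have "(SUP n. ereal (?E M n)) \<le> ereal e" by (intro SUP_least) simp
      then show ?case using e(2) by (rule le_less_trans)
    qed
  qed
qed

end
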